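(* Let $X_1,X_2,\dots$ be random variables such that for each $i\ge1$, $X_i\in\mathcal H_i$, $X_i$ is independent of $\mathcal F_{i-1}$, and $X_i$ is either bounded below or belongs to $L^1_b$. If $\sum_{i=1}^\infty\mathcal E\big((X_i-\mathcal E(X_i))^2\big)<\infty$, then the series $\sum_{i=1}^\infty(X_i-\mathcal E(X_i))$ converges quasi-surely.
   Context: Standing setting. $(\Omega,\mathcal F)$ is a measurable space with a discrete-time filtration $(\mathcal F_t)_{t\in\mathbb N}$, $\mathcal F_0$ trivial and $\mathcal F=\sigma(\bigcup_t\mathcal F_t)$. $\mathcal H$ is a linear space of $\mathcal F$-measurable real functions on $\Omega$ containing the constants, such that $X\in\mathcal H$ implies $|X|\in\mathcal H$ and $I_AX\in\mathcal H$ for all $A\in\mathcal F$; $\mathcal H_t:=\{X\in\mathcal H: X \text{ is } \mathcal F_t\text{-measurable}\}$. $(\mathcal E_t)$ is an $\mathcal{SL}$-expectation (a family of maps $\mathcal E_t:\mathcal H\to\mathcal H_t$ that are monotone, time-consistent $\mathcal E_s\circ\mathcal E_t=\mathcal E_s$ for $s\le t$, satisfy $\mathcal E_t(I_AY)=I_A\mathcal E_t(Y)$ for $A\in\mathcal F_t$, $\mathcal E_t(Y)=Y$ for $Y\in\mathcal H_t$, are subadditive, satisfy $\mathcal E_t(\lambda Y)=\lambda^+\mathcal E_t(Y)+\lambda^-\mathcal E_t(-Y)$ for $\lambda\in\mathcal H_t$, and $\mathcal E_0(X_i)\to0$ whenever $X_i\downarrow0$ pointwise); $\mathcal E:=\mathcal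 E_0$; $\mathbb V(A):=\mathcal E(I_A)$. "Quasi-surely" (q.s.) means outside a set $N$ with $\mathcal E(I_N)=0$. Independence: $Y\in\mathcal H$ is independent of $Z=(Z_1,\dots,Z_k)$ under $\mathcal E$ if for every measurable $\varphi$ with $\varphi(Z,Y)\in\mathcal H$ and $\varphi(z,Y)\in\mathcal H$ for all $z$, $\mathcal E[\varphi(Z,Y)]=\mathcal E[\bar\varphi(Z)]$ with $\bar\varphi(z):=\mathcal E[\varphi(z,Y)]$; $X$ is independent of $\mathcal F_n$ if $X$ is independent of $I_A$ for every $A\in\mathcal F_n$. $L^1_b$: the completion of bounded elements of $\mathcal H$ under $\mathcal E(|\cdot|)$, equivalently the $X\in L^1$ with $\lim_n\mathcal E(|X|I_{\{|X|>n\}})=0$. *)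

theory Defs
  imports "HOL-Analysis.Analysis"
begin

definition std_filtration :: "(nat \<Rightarrow> 'a measure) \<Rightarrow> bool" where
  "std_filtration Fs \<longleftrightarrow>
     (\<forall>t. space (Fs t) = UNIV) \<and>
     (\<forall>s t. s \<le> t \<longrightarrow> sets (Fs s) \<subseteq> sets (Fs t)) \<and>
     sets (Fs 0) = {{}, UNIV}"

definition Finf :: "(nat \<Rightarrow> 'a measure) \<Rightarrow> 'a measure" where
  "Finf Fs = sigma UNIV (\<Union>t. sets (Fs t))"

definition admissible_space :: "(nat \<Rightarrow> 'a measure) \<Rightarrow> ('a \<Rightarrow> real) set \<Rightarrow> bool" where
  "admissible_space Fs H \<longleftrightarrow>
     (\<forall>X\<in>H. X \<in> borel_measurable (Finf Fs)) \<and>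
     (\<forall>c::real. (\<lambda>_. c) \<in> H) \<and>
     (\<forall>X\<in>H. \<forall>Y\<in>H. (\<lambda>\<omega>. X \<omega> + Y \<omega>) \<in> H) \<and>
     (\<forall>X\<in>H. \<forall>c::real. (\<lambda>\<omega>. c * X \<omega>) \<in> H) \<and>
     (\<forall>X\<in>H. (\<lambda>\<omega>. \<bar>X \<omega>\<bar>) \<in> H) \<and>
     (\<forall>X\<in>H. \<forall>A\<in>sets (Finf Fs). (\<lambda>\<omega>. indicator A \<omega> * X \<omega>) \<in> H)"

definition Ht :: "(nat \<Rightarrow> 'a measure) \<Rightarrow> ('a \<Rightarrow> real) set \<Rightarrow> nat \<Rightarrow> ('a \<Rightarrow> real) set" where
  "Ht Fs H t = {X \<in> H. X \<in> borel_measurable (Fs t)}"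

text \<open>The sublinear expectation E_0, as a real number (E 0 X is constant since F_0 is trivial).\<close>
definition expc :: "(nat \<Rightarrow> ('a \<Rightarrow> real) \<Rightarrow> ('a \<Rightarrow> real)) \<Rightarrow> ('a \<Rightarrow> real) \<Rightarrow> real" where
  "expc E X = E 0 X undefined"

definition SL_expectation ::
  "(nat \<Rightarrow> 'a measure) \<Rightarrow> ('a \<Rightarrow> real) set \<Rightarrow> (nat \<Rightarrow> ('a \<Rightarrow> real) \<Rightarrow> ('a \<Rightarrow> real)) \<Rightarrow> bool" where
  "SL_expectation Fs H E \<longleftrightarrow>
     (\<forall>t. \<forall>X\<in>H. E t X \<in> Ht Fs H t) \<and>
     (\<forall>t. \<forall>X\<in>H. \<forall>Y\<in>H. (\<forall>\<omega>. X \<omega> \<le> Y \<omega>) \<longrightarrow> (\<forall>\<omega>. E t X \<omega> \<le> E t Y \<omega>)) \<and>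
     (\<forall>s t. \<forall>X\<in>H. s \<le> t \<longrightarrow> E s (E t X) = E s X) \<and>
     (\<forall>t. \<forall>A\<in>sets (Fs t). \<forall>Y\<in>H.
         E t (\<lambda>\<omega>. indicator A \<omega> * Y \<omega>) = (\<lambda>\<omega>. indicator A \<omega> * E t Y \<omega>)) \<and>
     (\<forall>t. \<forall>Y\<in>Ht Fs H t. E t Y = Y) \<and>
     (\<forall>t. \<forall>X\<in>H. \<forall>Y\<in>H. \<forall>\<omega>. E t (\<lambda>\<omega>. X \<omega> + Y \<omega>) \<omega> \<le> E t X \<omega> + E t Y \<omega>) \<and>
     (\<forall>t. \<forall>l\<in>Ht Fs H t. \<forall>Y\<in>H. (\<lambda>\<omega>. l \<omega> * Y \<omega>) \<in> H \<longrightarrow>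
         E t (\<lambda>\<omega>. l \<omega> * Y \<omega>) =
           (\<lambda>\<omega>. max (l \<omega>) 0 * E t Y \<omega> + max (- l \<omega>) 0 * E t (\<lambda>\<omega>'. - Y \<omega>') \<omega>)) \<and>
     (\<forall>Xs. (\<forall>i. Xs i \<in> H) \<and> (\<forall>i \<omega>. Xs (Suc i) \<omega> \<le> Xs i \<omega>) \<and>
           (\<forall>\<omega>. (\<lambda>i. Xs i \<omega>) \<longlonglongrightarrow> 0)
        \<longrightarrow> (\<lambda>i. expc E (Xs i)) \<longlonglongrightarrow> 0)"

definition quasi_surely ::
  "(nat \<Rightarrow> 'a measure) \<Rightarrow> (nat \<Rightarrow> ('a \<Rightarrow> real) \<Rightarrow> ('a \<Rightarrow> real)) \<Rightarrow> ('a \<Rightarrow> bool) \<Rightarrow> bool" where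
  "quasi_surely Fs E P \<longleftrightarrow>
     (\<exists>N\<in>sets (Finf Fs). expc E (indicator N) = 0 \<and> (\<forall>\<omega>. \<omega> \<notin> N \<longrightarrow> P \<omega>))"

definition indep_of ::
  "('a \<Rightarrow> real) set \<Rightarrow> (nat \<Rightarrow> ('a \<Rightarrow> real) \<Rightarrow> ('a \<Rightarrow> real)) \<Rightarrow> ('a \<Rightarrow> real) \<Rightarrow> ('a \<Rightarrow> real) \<Rightarrow> bool" where
  "indep_of H E Y Z \<longleftrightarrow>
     (\<forall>\<phi> :: real \<Rightarrow> real \<Rightarrow> real.
        case_prod \<phi> \<in> borel_measurable borel \<longrightarrow>
        (\<lambda>\<omega>. \<phi> (Z \<omega>) (Y \<omega>)) \<in> H \<longrightarrow>
        (\<forall>z. (\<lambda>\<omega>. \<phi> z (Y \<omega>)) \<in> H) \<longrightarrow>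
        expc E (\<lambda>\<omega>. \<phi> (Z \<omega>) (Y \<omega>)) =
        expc E (\<lambda>\<omega>. expc E (\<lambda>\<omega>'. \<phi> (Z \<omega>) (Y \<omega>'))))"

definition indep_of_filt ::
  "(nat \<Rightarrow> 'a measure) \<Rightarrow> ('a \<Rightarrow> real) set \<Rightarrow> (nat \<Rightarrow> ('a \<Rightarrow> real) \<Rightarrow> ('a \<Rightarrow> real))
     \<Rightarrow> ('a \<Rightarrow> real) \<Rightarrow> nat \<Rightarrow> bool" where
  "indep_of_filt Fs H E X n \<longleftrightarrow> (\<forall>A\<in>sets (Fs n). indep_of H E X (indicator A))"

definition L1b :: "(nat \<Rightarrow> ('a \<Rightarrow> real) \<Rightarrow> ('a \<Rightarrow> real)) \<Rightarrow> ('a \<Rightarrow> real) \<Rightarrow> bool" where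
  "L1b E X \<longleftrightarrow>
     (\<lambda>n::nat. expc E (\<lambda>\<omega>. \<bar>X \<omega>\<bar> * indicator {\<omega>'. \<bar>X \<omega>'\<bar> > real n} \<omega>)) \<longlonglongrightarrow> 0"

end

theory Submission
  imports Defs
begin

text \<open>
  Independence makes the conditional expectations of \<open>Y\<^sub>i = X\<^sub>i - e(X\<^sub>i)\<close> and \<open>- Y\<^sub>i\<close> given the past
  quasi-surely equal to the constants \<open>0\<close> and \<open>m\<^sub>i = e(- Y\<^sub>i) \<ge> 0\<close>. Since \<open>H\<close> need not be closed
  under products, each \<open>Y\<^sub>i\<close> is first replaced by a simple function of itself, with an error
  summable quasi-surely. A maximal inequality for sums stopped on leaving \<open>(-c, c)\<close> then bounds the
  oscillation by the tails of \<open>\<Sum> e(Y\<^sub>i\<^sup>2) + 2 c m\<^sub>i\<close>. The variance hypothesis does not mention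
  \<open>\<Sum> m\<^sub>i\<close>; that this series converges comes from the continuity of \<open>e\<close> from above.
\<close>

text \<open>For a linear expectation the cross terms of a squared partial sum vanish. Here the
  conditional expectation of W Z is W^+ E(Z) + W^- E(-Z), so with conditional values 0 and m a cross
  term costs 2 S^- m, where S is the sum so far. Stopping turns this into at most 2 c m. The
  variances only give m_i^2 <= e(Y_i^2), that is square summability of m, which does not suffice to
  sum these costs. Summability is obtained by contradiction: a divergent series would leave a large
  drift available after every time n. The lower bounds on capacities that this argument requires
  come from negative quadratic minorants of indicators, evaluated through the conditional
  expectations, so no family of dominated linear expectations has to be constructed.\<close>

locale sublinear_expectation =
  fixes Fs :: "nat \<Rightarrow> 'a measure"
    and H :: "('a \<Rightarrow> real) set"
    and E :: "nat \<Rightarrow> ('a \<Rightarrow> real) \<Rightarrow> ('a \<Rightarrow> real)"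
  assumes filt: "std_filtration Fs"
    and adm: "admissible_space Fs H"
    and SL: "SL_expectation Fs H E"
begin

abbreviation e :: "('a \<Rightarrow> real) \<Rightarrow> real" where "e \<equiv> expc E"
abbreviation qs :: "('a \<Rightarrow> bool) \<Rightarrow> bool" where "qs \<equiv> quasi_surely Fs E"

section \<open>Closure of \<open>H\<close> and elementary calculus of the conditional
  expectations\<close>

lemma space_Fs [simp]: "space (Fs t) = UNIV"
  using filt by (simp add: std_filtration_def)

lemma space_Finf [simp]: "space (Finf Fs) = UNIV"
  by (simp add: Finf_def)

lemma sets_Fs_mono: "s \<le> t \<Longrightarrow> sets (Fs s) \<subseteq> sets (Fs t)"
  using filt by (simp add: std_filtration_def)

lemma sets_Fs_Finf: "A \<in> sets (Fs t) \<Longrightarrow> A \<in> sets (Finf Fs)"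
  by (auto simp: Finf_def)

lemma H_measurable: "X \<in> H \<Longrightarrow> X \<in> borel_measurable (Finf Fs)"
  using adm by (simp add: admissible_space_def)

lemma H_const: "(\<lambda>_. c) \<in> H"
  and H_add: "X \<in> H \<Longrightarrow> Y \<in> H \<Longrightarrow> (\<lambda>\<omega>. X \<omega> + Y \<omega>) \<in> H"
  and H_scale: "X \<in> H \<Longrightarrow> (\<lambda>\<omega>. c * X \<omega>) \<in> H"
  and H_abs: "X \<in> H \<Longrightarrow> (\<lambda>\<omega>. \<bar>X \<omega>\<bar>) \<in> H"
  and H_indicator_mult: "X \<in> H \<Longrightarrow> A \<in> sets (Finf Fs) \<Longrightarrow> (\<lambda>\<omega>. indicator A \<omega> * X \<omega>) \<in> H"
  using adm by (auto simp: admissible_space_def)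

lemma H_uminus: "X \<in> H \<Longrightarrow> (\<lambda>\<omega>. - X \<omega>) \<in> H"
  using H_scale[of X "-1"] by simp

lemma H_diff: "X \<in> H \<Longrightarrow> Y \<in> H \<Longrightarrow> (\<lambda>\<omega>. X \<omega> - Y \<omega>) \<in> H"
  using H_add[of X "\<lambda>\<omega>. - Y \<omega>"] H_uminus[of Y] by simp

lemma H_indicator: "A \<in> sets (Finf Fs) \<Longrightarrow> (indicator A :: 'a \<Rightarrow> real) \<in> H"
  using H_indicator_mult[OF H_const[of 1], of A] by (simp cong: if_cong)

lemma H_sum: "finite I \<Longrightarrow> (\<And>i. i \<in> I \<Longrightarrow> X i \<in> H) \<Longrightarrow> (\<lambda>\<omega>. \<Sum>i\<in>I. X i \<omega>) \<in> H"
  by (induction I rule: finite_induct) (auto intro: H_const H_add)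

lemmas H_intros = H_const H_add H_scale H_abs H_uminus H_diff H_indicator_mult H_indicator

lemma HtI: "X \<in> H \<Longrightarrow> X \<in> borel_measurable (Fs t) \<Longrightarrow> X \<in> Ht Fs H t"
  by (simp add: Ht_def)

lemma E_Ht: "X \<in> H \<Longrightarrow> E t X \<in> Ht Fs H t"
  using SL by (simp add: SL_expectation_def)

lemma E_H: "X \<in> H \<Longrightarrow> E t X \<in> H"
  and E_measurable: "X \<in> H \<Longrightarrow> E t X \<in> borel_measurable (Fs t)"
  using E_Ht[of X t] by (auto simp: Ht_def)

lemma E_mono: "X \<in> H \<Longrightarrow> Y \<in> H \<Longrightarrow> (\<And>\<omega>. X \<omega> \<le> Y \<omega>) \<Longrightarrow> E t X \<omega> \<le> E t Y \<omega>"
  using SL by (simp add: SL_expectation_def)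

lemma E_indicator: "A \<in> sets (Fs t) \<Longrightarrow> Y \<in> H \<Longrightarrow>
    E t (\<lambda>\<omega>. indicator A \<omega> * Y \<omega>) = (\<lambda>\<omega>. indicator A \<omega> * E t Y \<omega>)"
  using SL by (simp add: SL_expectation_def)

lemma E_id: "Y \<in> Ht Fs H t \<Longrightarrow> E t Y = Y"
  using SL by (simp add: SL_expectation_def)

lemma E_subadd: "X \<in> H \<Longrightarrow> Y \<in> H \<Longrightarrow> E t (\<lambda>\<omega>. X \<omega> + Y \<omega>) \<omega> \<le> E t X \<omega> + E t Y \<omega>"
  using SL by (simp add: SL_expectation_def)

lemma E_mult: "l \<in> Ht Fs H t \<Longrightarrow> Y \<in> H \<Longrightarrow> (\<lambda>\<omega>. l \<omega> * Y \<omega>) \<in> H \<Longrightarrow>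
    E t (\<lambda>\<omega>. l \<omega> * Y \<omega>) \<omega> = max (l \<omega>) 0 * E t Y \<omega> + max (- l \<omega>) 0 * E t (\<lambda>\<omega>'. - Y \<omega>') \<omega>"
  using SL by (simp add: SL_expectation_def)

text \<open>Subadditivity gives one half. For the other, write V as (U + V) + (-U); since -U is
  F_t-measurable too, \<open>E t\<close> fixes it.\<close>

lemma E_add_known:
  assumes U: "U \<in> Ht Fs H t" and V: "V \<in> H"
  shows "E t (\<lambda>\<omega>. U \<omega> + V \<omega>) \<omega> = U \<omega> + E t V \<omega>"
proof (rule antisym)
  have UH: "U \<in> H" and Um: "U \<in> borel_measurable (Fs t)" using U by (auto simp: Ht_def)
  show "E t (\<lambda>\<omega>. U \<omega> + V \<omega>) \<omega> \<le> U \<omega> + E t V \<omega>"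
    using E_subadd[OF UH V, of t \<omega>] E_id[OF U] by simp
  have "(\<lambda>\<omega>. - U \<omega>) \<in> Ht Fs H t" using UH Um by (intro HtI H_uminus) auto
  then show "U \<omega> + E t V \<omega> \<le> E t (\<lambda>\<omega>. U \<omega> + V \<omega>) \<omega>"
    using E_subadd[of "\<lambda>\<omega>. U \<omega> + V \<omega>" "\<lambda>\<omega>. - U \<omega>" t \<omega>] E_id[of "\<lambda>\<omega>. - U \<omega>" t] UH V
    by (simp add: H_intros)
qed

lemma e_mono: "X \<in> H \<Longrightarrow> Y \<in> H \<Longrightarrow> (\<And>\<omega>. X \<omega> \<le> Y \<omega>) \<Longrightarrow> e X \<le> e Y"
  unfolding expc_def by (rule E_mono)

lemma e_subadd: "X \<in> H \<Longrightarrow> Y \<in> H \<Longrightarrow> e (\<lambda>\<omega>. X \<omega> + Y \<omega>) \<le> e X + e Y"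
  unfolding expc_def by (rule E_subadd)

lemma e_const [simp]: "e (\<lambda>_. c) = c"
  using E_id[of "\<lambda>_. c" 0] by (simp add: expc_def HtI H_const)

lemma e_scale: "0 \<le> c \<Longrightarrow> X \<in> H \<Longrightarrow> e (\<lambda>\<omega>. c * X \<omega>) = c * e X"
  using E_mult[of "\<lambda>_. c" 0 X undefined] by (simp add: expc_def HtI H_intros)

lemma e_add_const: "X \<in> H \<Longrightarrow> e (\<lambda>\<omega>. X \<omega> + c) = e X + c"
  using E_add_known[of "\<lambda>_. c" 0 X undefined] by (simp add: expc_def HtI H_intros add.commute)

lemma e_E: "X \<in> H \<Longrightarrow> e (E t X) = e X"
  using SL by (simp add: SL_expectation_def expc_def)

lemma e_continuous:
  assumes "\<And>i. X i \<in> H" "\<And>i \<omega>. X (Suc i) \<omega> \<le> X i \<omega>" "\<And>\<omega>. (\<lambda>i. X i \<omega>) \<longlonglongrightarrow> 0"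
  shows "(\<lambda>i. e (X i)) \<longlonglongrightarrow> 0"
  using SL assms unfolding SL_expectation_def by blast

lemma e_nonneg: "X \<in> H \<Longrightarrow> (\<And>\<omega>. 0 \<le> X \<omega>) \<Longrightarrow> 0 \<le> e X"
  using e_mono[of "\<lambda>_. 0" X] by (simp add: H_const)

lemma e_diff_ge: "X \<in> H \<Longrightarrow> Y \<in> H \<Longrightarrow> e X - e Y \<le> e (\<lambda>\<omega>. X \<omega> - Y \<omega>)"
  using e_subadd[of "\<lambda>\<omega>. X \<omega> - Y \<omega>" Y] by (simp add: H_diff)

lemma e_diff_abs_le:
  assumes "X \<in> H" "Y \<in> H" shows "\<bar>e X - e Y\<bar> \<le> e (\<lambda>\<omega>. \<bar>X \<omega> - Y \<omega>\<bar>)"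
proof -
  have "e X - e Y \<le> e (\<lambda>\<omega>. \<bar>X \<omega> - Y \<omega>\<bar>)"
    using e_diff_ge[OF assms] e_mono[of "\<lambda>\<omega>. X \<omega> - Y \<omega>" "\<lambda>\<omega>. \<bar>X \<omega> - Y \<omega>\<bar>"] assms
    by (force simp: H_intros)
  moreover have "e Y - e X \<le> e (\<lambda>\<omega>. \<bar>X \<omega> - Y \<omega>\<bar>)"
    using e_diff_ge[OF assms(2,1)] e_mono[of "\<lambda>\<omega>. Y \<omega> - X \<omega>" "\<lambda>\<omega>. \<bar>X \<omega> - Y \<omega>\<bar>"] assms
    by (force simp: H_intros)
  ultimately show ?thesis by linarith
qed

subsection \<open>Null sets and quasi-sure properties\<close>

lemma V_mono:
  "A \<in> sets (Finf Fs) \<Longrightarrow> B \<in> sets (Finf Fs) \<Longrightarrow> A \<subseteq> B \<Longrightarrow> e (indicator A) \<le> e (indicator B)"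
  by (rule e_mono) (auto intro: H_indicator simp: indicator_def)

lemma V_nonneg: "A \<in> sets (Finf Fs) \<Longrightarrow> 0 \<le> e (indicator A)"
  by (rule e_nonneg) (auto intro: H_indicator)

lemma V_le_add:
  assumes "A \<in> sets (Finf Fs)" "B \<in> sets (Finf Fs)" "C \<in> sets (Finf Fs)" "A \<subseteq> B \<union> C"
  shows "e (indicator A) \<le> e (indicator B) + e (indicator C)"
proof -
  have "e (indicator A) \<le> e (\<lambda>\<omega>. indicator B \<omega> + indicator C \<omega>)"
    using assms by (intro e_mono H_intros) (auto simp: indicator_def)
  also have "\<dots> \<le> e (indicator B) + e (indicator C)"
    using assms by (intro e_subadd H_intros)
  finally show ?thesis .
qed

lemma V_continuous:
  assumes A: "\<And>i. A i \<in> sets (Finf Fs)" and dec: "\<And>i. A (Suc i) \<subseteq> A i" and emp: "(\<Inter>i. A i) = {}"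
  shows "(\<lambda>i. e (indicator (A i))) \<longlonglongrightarrow> 0"
proof (rule e_continuous)
  show "indicator (A i) \<in> H" for i using A by (rule H_indicator)
  show "indicator (A (Suc i)) \<omega> \<le> (indicator (A i) \<omega> :: real)" for i \<omega>
    using dec[of i] by (auto simp: indicator_def)
  show "(\<lambda>i. indicator (A i) \<omega> :: real) \<longlonglongrightarrow> 0" for \<omega>
  proof -
    obtain k where k: "\<omega> \<notin> A k" using emp by blast
    have "decseq A" using dec by (simp add: decseq_Suc_iff)
    then have "eventually (\<lambda>i. indicator (A i) \<omega> = (0::real)) sequentially"
      using k by (auto simp: eventually_sequentially decseq_def indicator_def intro!: exI[of _ k])
    then show ?thesis by (rule tendsto_eventually)
  qed
qed

text \<open>Subadditivity is only finite; the part of the union missed by the first n sets decreases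
  to the empty set, so continuity from above makes its capacity vanish. Countable estimates on
  capacities below rest on this.\<close>

lemma V_UN_le:
  assumes A: "\<And>i::nat. A i \<in> sets (Finf Fs)" and bound: "\<And>n. e (indicator (\<Union>i<n. A i)) \<le> c"
  shows "e (indicator (\<Union>i. A i)) \<le> c"
proof -
  let ?D = "\<lambda>n. (\<Union>i. A i) - (\<Union>i<n. A i)"
  have "(\<lambda>n. e (indicator (?D n))) \<longlonglongrightarrow> 0"
  proof (rule V_continuous)
    show "?D n \<in> sets (Finf Fs)" for n using A by auto
    show "?D (Suc n) \<subseteq> ?D n" for n by (auto simp: less_Suc_eq)
    show "(\<Inter>n. ?D n) = {}" by (auto intro: lessI)
  qed
  then have lim: "(\<lambda>n. c + e (indicator (?D n))) \<longlonglongrightarrow> c + 0"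
    by (intro tendsto_intros)
  have le: "e (indicator (\<Union>i. A i)) \<le> c + e (indicator (?D n))" for n
  proof -
    have "e (indicator (\<Union>i. A i)) \<le> e (indicator (\<Union>i<n. A i)) + e (indicator (?D n))"
      using A by (intro V_le_add) auto
    then show ?thesis using bound[of n] by linarith
  qed
  show ?thesis using tendsto_lowerbound[OF lim always_eventually] le by simp
qed

lemma V_UN_lessThan_le:
  fixes A :: "nat \<Rightarrow> 'a set"
  assumes "\<And>i. A i \<in> sets (Finf Fs)"
  shows "e (indicator (\<Union>i<n. A i)) \<le> (\<Sum>i<n. e (indicator (A i)))"
proof (induction n)
  case 0
  then show ?case by (simp add: indicator_def[abs_def])
next
  case (Suc n)
  have "e (indicator (\<Union>i<Suc n. A i)) \<le> e (indicator (\<Union>i<n. A i)) + e (indicator (A n))"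
    using assms by (intro V_le_add) (auto simp: less_Suc_eq)
  then show ?case using Suc by simp
qed

lemma null_UN:
  assumes A: "\<And>i::nat. A i \<in> sets (Finf Fs)" and null: "\<And>i. e (indicator (A i)) = 0"
  shows "e (indicator (\<Union>i. A i)) = 0"
proof (rule antisym)
  show "e (indicator (\<Union>i. A i)) \<le> 0"
    using V_UN_le[OF A, where c = 0] V_UN_lessThan_le[OF A] null by simp
  show "0 \<le> e (indicator (\<Union>i. A i))" using A by (intro V_nonneg) auto
qed

lemma qs_all_nat:
  assumes "\<And>i::nat. qs (P i)" shows "qs (\<lambda>\<omega>. \<forall>i. P i \<omega>)"
proof -
  obtain N where "\<And>i. N i \<in> sets (Finf Fs)" "\<And>i. e (indicator (N i)) = 0" "\<And>i \<omega>. \<omega> \<notin> N i \<Longrightarrow> P i \<omega>"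
    using assms unfolding quasi_surely_def by metis
  then show ?thesis unfolding quasi_surely_def
    by (intro bexI[of _ "\<Union>i. N i"]) (auto intro: null_UN)
qed

lemma qs_mono: "qs P \<Longrightarrow> (\<And>\<omega>. P \<omega> \<Longrightarrow> Q \<omega>) \<Longrightarrow> qs Q"
  unfolding quasi_surely_def by blast

lemma qs_conj:
  assumes "qs P" "qs Q" shows "qs (\<lambda>\<omega>. P \<omega> \<and> Q \<omega>)"
proof -
  have "qs (\<lambda>\<omega>. \<forall>i::nat. if i = 0 then P \<omega> else Q \<omega>)"
    using assms by (intro qs_all_nat) (case_tac "i = 0", auto)
  then show ?thesis by (rule qs_mono) (metis zero_neq_one)
qed

section \<open>Tails of elements of \<open>H\<close> and comparison outside null sets\<close>

lemma tail_sets: "G \<in> H \<Longrightarrow> {\<omega>. c < \<bar>G \<omega>\<bar>} \<in> sets (Finf Fs)"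
  using measurable_sets[OF borel_measurable_abs[OF H_measurable], of G "{c<..}"]
  by (simp add: vimage_def)

text \<open>At each point the tail is zero as soon as n reaches |G|, and it decreases in n, so
  continuity from above applies.\<close>

lemma e_tail_tendsto_0:
  assumes G: "G \<in> H"
  shows "(\<lambda>n::nat. e (\<lambda>\<omega>. indicator {\<omega>. real n < \<bar>G \<omega>\<bar>} \<omega> * \<bar>G \<omega>\<bar>)) \<longlonglongrightarrow> 0"
proof (rule e_continuous)
  show "(\<lambda>\<omega>. indicator {\<omega>. real n < \<bar>G \<omega>\<bar>} \<omega> * \<bar>G \<omega>\<bar>) \<in> H" for n
    using G by (intro H_intros tail_sets)
  show "indicator {\<omega>. real (Suc n) < \<bar>G \<omega>\<bar>} \<omega> * \<bar>G \<omega>\<bar> \<le> indicator {\<omega>. real n < \<bar>G \<omega>\<bar>} \<omega> * \<bar>G \<omega>\<bar>" for n \<omega>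
    by (auto simp: indicator_def)
  show "(\<lambda>n::nat. indicator {\<omega>. real n < \<bar>G \<omega>\<bar>} \<omega> * \<bar>G \<omega>\<bar>) \<longlonglongrightarrow> 0" for \<omega>
  proof (rule tendsto_eventually)
    show "\<forall>\<^sub>F n in sequentially. indicator {\<omega>. real n < \<bar>G \<omega>\<bar>} \<omega> * \<bar>G \<omega>\<bar> = 0"
      using eventually_ge_at_top[of "nat \<lceil>\<bar>G \<omega>\<bar>\<rceil>"]
      by eventually_elim (auto simp: indicator_def)
  qed
qed

text \<open>On N bound |G| by n plus its tail beyond n: the first part has expectation n * 0, the
  second tends to 0. Thus unbounded functions too may be altered on null sets.\<close>

lemma e_null:
  assumes G: "G \<in> H" and N: "N \<in> sets (Finf Fs)" and null: "e (indicator N) = 0"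
  shows "e (\<lambda>\<omega>. indicator N \<omega> * \<bar>G \<omega>\<bar>) \<le> 0"
proof (rule tendsto_lowerbound[OF e_tail_tendsto_0[OF G] always_eventually trivial_limit_sequentially], rule allI)
  fix n :: nat
  let ?T = "\<lambda>\<omega>. indicator {\<omega>. real n < \<bar>G \<omega>\<bar>} \<omega> * \<bar>G \<omega>\<bar>"
  have "e (\<lambda>\<omega>. indicator N \<omega> * \<bar>G \<omega>\<bar>) \<le> e (\<lambda>\<omega>. real n * indicator N \<omega> + ?T \<omega>)"
    using G N by (intro e_mono H_intros tail_sets) (auto simp: indicator_def)
  also have "\<dots> \<le> e (\<lambda>\<omega>. real n * indicator N \<omega>) + e ?T"
    using G N by (intro e_subadd H_intros tail_sets)
  also have "e (\<lambda>\<omega>. real n * indicator N \<omega>) = 0"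
    using e_scale[of "real n" "indicator N"] N null by (simp add: H_intros)
  finally show "e (\<lambda>\<omega>. indicator N \<omega> * \<bar>G \<omega>\<bar>) \<le> e ?T" by simp
qed

lemma e_mono_qs:
  assumes X: "X \<in> H" and Y: "Y \<in> H" and le: "qs (\<lambda>\<omega>. X \<omega> \<le> Y \<omega>)"
  shows "e X \<le> e Y"
proof -
  obtain N where N: "N \<in> sets (Finf Fs)" "e (indicator N) = 0" "\<And>\<omega>. \<omega> \<notin> N \<Longrightarrow> X \<omega> \<le> Y \<omega>"
    using le unfolding quasi_surely_def by blast
  have "e X \<le> e (\<lambda>\<omega>. Y \<omega> + indicator N \<omega> * \<bar>X \<omega> - Y \<omega>\<bar>)"
    using X Y N by (intro e_mono H_intros) (auto simp: indicator_def)
  also have "\<dots> \<le> e Y + e (\<lambda>\<omega>. indicator N \<omega> * \<bar>X \<omega> - Y \<omega>\<bar>)"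
    using X Y N by (intro e_subadd H_intros)
  finally show ?thesis using e_null[OF H_diff[OF X Y] N(1,2)] by linarith
qed

lemma e_cong_qs: "X \<in> H \<Longrightarrow> Y \<in> H \<Longrightarrow> qs (\<lambda>\<omega>. X \<omega> = Y \<omega>) \<Longrightarrow> e X = e Y"
  by (intro antisym e_mono_qs) (auto elim: qs_mono)

lemma markov:
  assumes X: "X \<in> H" and A: "A \<in> sets (Finf Fs)" and c: "0 < c"
    and nn: "\<And>\<omega>. 0 \<le> X \<omega>" and ge: "\<And>\<omega>. \<omega> \<in> A \<Longrightarrow> c \<le> X \<omega>"
  shows "e (indicator A) \<le> e X / c"
proof -
  have "c * e (indicator A) = e (\<lambda>\<omega>. c * indicator A \<omega>)"
    using c A by (simp add: e_scale H_intros)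
  also have "\<dots> \<le> e X"
    using X A nn ge by (intro e_mono H_intros) (auto simp: indicator_def)
  finally show ?thesis using c by (simp add: field_simps)
qed

text \<open>The limsup event lies in every tail union, whose capacity is at most a tail of the
  convergent series.\<close>

lemma borel_cantelli:
  assumes A: "\<And>i::nat. A i \<in> sets (Finf Fs)" and summ: "summable (\<lambda>i. e (indicator (A i)))"
  shows "qs (\<lambda>\<omega>. \<exists>n. \<forall>i\<ge>n. \<omega> \<notin> A i)"
proof -
  let ?B = "\<lambda>n. \<Union>i. A (i + n)"
  have B: "?B n \<in> sets (Finf Fs)" for n using A by auto
  then have I: "(\<Inter>n. ?B n) \<in> sets (Finf Fs)" by auto
  have "e (indicator (\<Inter>n. ?B n)) \<le> 0"
  proof (rule field_le_epsilon)
    fix r :: real assume "0 < r"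
    then obtain n where n: "norm (\<Sum>i. e (indicator (A (i + n)))) < r"
      using suminf_exist_split[OF _ summ, of r] by auto
    have "e (indicator (\<Inter>n. ?B n)) \<le> e (indicator (?B n))"
      using I B by (intro V_mono) auto
    also have "\<dots> \<le> (\<Sum>i. e (indicator (A (i + n))))"
    proof (rule V_UN_le)
      show "A (i + n) \<in> sets (Finf Fs)" for i by (rule A)
      fix N
      have "e (indicator (\<Union>i<N. A (i + n))) \<le> (\<Sum>i<N. e (indicator (A (i + n))))"
        by (rule V_UN_lessThan_le[OF A])
      also have "\<dots> \<le> (\<Sum>i. e (indicator (A (i + n))))"
        using summ A summable_iff_shift[of "\<lambda>i. e (indicator (A i))" n]
        by (intro sum_le_suminf) (auto intro: V_nonneg)
      finally show "e (indicator (\<Union>i<N. A (i + n))) \<le> (\<Sum>i. e (indicator (A (i + n))))" .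
    qed
    finally show "e (indicator (\<Inter>n. ?B n)) \<le> 0 + r" using n by simp
  qed
  then have "e (indicator (\<Inter>n. ?B n)) = 0" using V_nonneg[OF I] by linarith
  moreover have "\<exists>n. \<forall>i\<ge>n. \<omega> \<notin> A i" if out: "\<omega> \<notin> (\<Inter>n. ?B n)" for \<omega>
  proof -
    obtain n where n: "\<And>i. \<omega> \<notin> A (i + n)" using out by blast
    have "\<omega> \<notin> A i" if "n \<le> i" for i using n[of "i - n"] that by simp
    then show ?thesis by blast
  qed
  ultimately show ?thesis using I unfolding quasi_surely_def by blast
qed

subsection \<open>Independence\<close>

text \<open>Independence speaks of \<open>e\<close> only, so Z is recovered by testing it on the two
  F_n-events where it misses c by at least d. On A the test function dominates d times the indicator
  of A, yet has expectation 0. For B the penalty with k = d keeps the test function at most -d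
  everywhere, while its expectation is \<open>d * (e (indicator B) - 1)\<close>. Both events are
  then null.\<close>

lemma E_indep_approx:
  assumes X: "X \<in> H" and gX: "(\<lambda>\<omega>. g (X \<omega>)) \<in> H" and g: "g \<in> borel_measurable borel"
    and ind: "indep_of_filt Fs H E X n" and d: "0 < d"
  defines "c \<equiv> e (\<lambda>\<omega>. g (X \<omega>))"
  shows "qs (\<lambda>\<omega>. E n (\<lambda>\<omega>. g (X \<omega>)) \<omega> < c + d \<and> c - d < E n (\<lambda>\<omega>. g (X \<omega>)) \<omega>)"
proof -
  define Z where "Z = E n (\<lambda>\<omega>. g (X \<omega>))"
  have Z: "Z \<in> H" "Z \<in> borel_measurable (Fs n)"
    using E_H[OF gX] E_measurable[OF gX] by (auto simp: Z_def)
  \<comment> \<open>The term with \<open>k\<close> is a penalty off \<open>A\<close>: for \<open>k = 0\<close> the identity only bounds \<open>Z\<close> from above.\<close>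
  have key: "e (\<lambda>\<omega>. indicator A \<omega> * (Z \<omega> - c) + k * (indicator A \<omega> - 1)) = k * (e (indicator A) - 1)"
    if A: "A \<in> sets (Fs n)" and k: "0 \<le> k" for A k
  proof -
    have AF: "A \<in> sets (Finf Fs)" using A by (rule sets_Fs_Finf)
    let ?\<phi> = "\<lambda>z y. z * (g y - c) + k * (z - 1)"
    have H1: "(\<lambda>\<omega>. ?\<phi> (indicator A \<omega>) (X \<omega>)) \<in> H" using gX AF by (intro H_intros)
    have H2: "(\<lambda>\<omega>. ?\<phi> z (X \<omega>)) \<in> H" for z using gX by (intro H_intros)
    have "indep_of H E X (indicator A)" using ind A by (simp add: indep_of_filt_def)
    moreover have "case_prod ?\<phi> \<in> borel_measurable borel"
    proof -
      have "(\<lambda>p. fst p * (g (snd p) - c) + k * (fst p - 1)) \<in> borel_measurable (borel \<Otimes>\<^sub>M borel)"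
        using g by measurable
      then show ?thesis by (simp add: borel_prod case_prod_beta')
    qed
    ultimately have eq: "e (\<lambda>\<omega>. ?\<phi> (indicator A \<omega>) (X \<omega>)) = e (\<lambda>\<omega>. e (\<lambda>\<omega>'. ?\<phi> (indicator A \<omega>) (X \<omega>')))"
      using H1 H2 unfolding indep_of_def by blast
    have 1: "e (\<lambda>\<omega>'. g (X \<omega>') - c) = 0"
      using e_add_const[OF gX, of "- c"] by (simp add: c_def)
    \<comment> \<open>The indicator takes only the values 0 and 1: the inner expectation is 0 at z =
      1 and -k at z = 0.\<close>
    have "(\<lambda>\<omega>. e (\<lambda>\<omega>'. ?\<phi> (indicator A \<omega>) (X \<omega>'))) = (\<lambda>\<omega>. k * indicator A \<omega> + - k)"
      by (rule ext) (auto simp: indicator_def 1)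
    then have R: "e (\<lambda>\<omega>. e (\<lambda>\<omega>'. ?\<phi> (indicator A \<omega>) (X \<omega>'))) = k * (e (indicator A) - 1)"
      using e_add_const[of "\<lambda>\<omega>. k * indicator A \<omega>" "- k"] k AF
      by (simp add: H_intros e_scale algebra_simps)
    \<comment> \<open>Conditioning on F_n evaluates the same integrand a second way, with g(X)
      replaced by Z; \<open>e_E\<close> then equates the two evaluations.\<close>
    have "E n (\<lambda>\<omega>. ?\<phi> (indicator A \<omega>) (X \<omega>)) \<omega> = indicator A \<omega> * (Z \<omega> - c) + k * (indicator A \<omega> - 1)" for \<omega>
    proof -
      have "(\<lambda>\<omega>. k * (indicator A \<omega> - 1)) \<in> Ht Fs H n" using AF A by (intro HtI H_intros) auto
      then have "E n (\<lambda>\<omega>. k * (indicator A \<omega> - 1) + indicator A \<omega> * (g (X \<omega>) - c)) \<omega>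
          = k * (indicator A \<omega> - 1) + E n (\<lambda>\<omega>. indicator A \<omega> * (g (X \<omega>) - c)) \<omega>"
        using gX AF by (intro E_add_known H_intros)
      moreover have "E n (\<lambda>\<omega>. indicator A \<omega> * (g (X \<omega>) - c)) \<omega> = indicator A \<omega> * E n (\<lambda>\<omega>. g (X \<omega>) - c) \<omega>"
        using E_indicator[OF A, of "\<lambda>\<omega>. g (X \<omega>) - c"] gX by (simp add: H_intros)
      moreover have "E n (\<lambda>\<omega>. - c + g (X \<omega>)) \<omega> = - c + Z \<omega>"
        unfolding Z_def using gX by (intro E_add_known HtI H_intros) auto
      ultimately show ?thesis by (simp add: add.commute)
    qed
    then have "E n (\<lambda>\<omega>. ?\<phi> (indicator A \<omega>) (X \<omega>)) = (\<lambda>\<omega>. indicator A \<omega> * (Z \<omega> - c) + k * (indicator A \<omega> - 1))"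
      by blast
    then show ?thesis using e_E[OF H1, of n] eq R by simp
  qed
  define A where "A = {\<omega>. c + d \<le> Z \<omega>}"
  define B where "B = {\<omega>. Z \<omega> \<le> c - d}"
  have "{\<omega> \<in> space (Fs n). c + d \<le> Z \<omega>} \<in> sets (Fs n)" "{\<omega> \<in> space (Fs n). Z \<omega> \<le> c - d} \<in> sets (Fs n)"
    using Z by measurable
  then have AB: "A \<in> sets (Fs n)" "B \<in> sets (Fs n)" by (auto simp: A_def B_def)
  then have ABF: "A \<in> sets (Finf Fs)" "B \<in> sets (Finf Fs)" by (auto intro: sets_Fs_Finf)
  have "d * e (indicator A) \<le> 0"
  proof -
    have "e (\<lambda>\<omega>. d * indicator A \<omega>) \<le> e (\<lambda>\<omega>. indicator A \<omega> * (Z \<omega> - c) + 0 * (indicator A \<omega> - 1))"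
      using Z ABF by (intro e_mono H_intros) (auto simp: indicator_def A_def)
    then show ?thesis using key[OF AB(1), of 0] d ABF by (simp add: e_scale H_intros)
  qed
  then have "e (indicator A) = 0"
    using d V_nonneg[OF ABF(1)] by (simp add: mult_le_0_iff)
  moreover have "e (indicator B) = 0"
  proof -
    have "e (\<lambda>\<omega>. indicator B \<omega> * (Z \<omega> - c) + d * (indicator B \<omega> - 1)) \<le> e (\<lambda>_. - d)"
      using Z ABF by (intro e_mono H_intros) (auto simp: indicator_def B_def)
    then have "d * e (indicator B) \<le> 0" using key[OF AB(2), of d] d by (simp add: algebra_simps)
    then show ?thesis using d V_nonneg[OF ABF(2)] by (simp add: mult_le_0_iff)
  qed
  ultimately have "qs (\<lambda>\<omega>. \<omega> \<notin> A)" "qs (\<lambda>\<omega>. \<omega> \<notin> B)"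
    using ABF by (auto simp: quasi_surely_def)
  then have "qs (\<lambda>\<omega>. \<omega> \<notin> A \<and> \<omega> \<notin> B)" by (rule qs_conj)
  then show ?thesis unfolding Z_def[symmetric] by (rule qs_mono) (auto simp: A_def B_def)
qed

text \<open>Tolerances 1/(k+1) exhaust the event of inequality. The Borel function g is kept so that
  independence of X also covers the simplified increments and their negatives.\<close>

lemma E_indep:
  assumes "X \<in> H" "(\<lambda>\<omega>. g (X \<omega>)) \<in> H" "g \<in> borel_measurable borel" "indep_of_filt Fs H E X n"
  shows "qs (\<lambda>\<omega>. E n (\<lambda>\<omega>. g (X \<omega>)) \<omega> = e (\<lambda>\<omega>. g (X \<omega>)))"
proof -
  let ?Z = "E n (\<lambda>\<omega>. g (X \<omega>))" and ?c = "e (\<lambda>\<omega>. g (X \<omega>))"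
  have "qs (\<lambda>\<omega>. \<forall>k::nat. ?Z \<omega> < ?c + inverse (real (Suc k)) \<and> ?c - inverse (real (Suc k)) < ?Z \<omega>)"
    using assms by (intro qs_all_nat E_indep_approx) auto
  then show ?thesis
  proof (rule qs_mono)
    fix \<omega> assume *: "\<forall>k::nat. ?Z \<omega> < ?c + inverse (real (Suc k)) \<and> ?c - inverse (real (Suc k)) < ?Z \<omega>"
    show "?Z \<omega> = ?c"
    proof (rule ccontr)
      assume "?Z \<omega> \<noteq> ?c"
      then have "0 < \<bar>?Z \<omega> - ?c\<bar>" by simp
      then obtain k where "inverse (real (Suc k)) < \<bar>?Z \<omega> - ?c\<bar>" using reals_Archimedean by blast
      then show False using *[rule_format, of k] by linarith
    qed
  qed
qed

subsection \<open>Simple functions\<close>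

lemma simple_mono: "simple_function (Fs s) f \<Longrightarrow> s \<le> t \<Longrightarrow> simple_function (Fs t) f"
  using sets_Fs_mono[of s t] by (auto simp: simple_function_def)

text \<open>Sums, products and compositions of simple functions are simple, so this settles
  membership in \<open>H\<close> for the quadratic expressions built from them.\<close>

lemma simple_H:
  fixes f :: "'a \<Rightarrow> real"
  assumes "simple_function (Fs t) f" shows "f \<in> H"
proof -
  have fin: "finite (range f)" using assms by (simp add: simple_function_def)
  have s: "f -` {y} \<in> sets (Fs t)" for y
    using simple_functionD(2)[OF assms, of "{y}"] by simp
  have "f = (\<lambda>\<omega>. \<Sum>y\<in>range f. y * indicator (f -` {y}) \<omega>)"
  proof
    fix \<omega>
    have "(\<Sum>y\<in>range f. y * indicator (f -` {y}) \<omega>) = (\<Sum>y\<in>range f. if f \<omega> = y then y else 0)"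
      by (intro sum.cong) (auto simp: indicator_def)
    then show "f \<omega> = (\<Sum>y\<in>range f. y * indicator (f -` {y}) \<omega>)" using fin by simp
  qed
  moreover have "\<dots> \<in> H" using fin s by (intro H_sum H_intros) (auto intro: sets_Fs_Finf)
  ultimately show ?thesis by simp
qed

lemma simple_Ht: "simple_function (Fs t) f \<Longrightarrow> f \<in> Ht Fs H t" for f :: "'a \<Rightarrow> real"
  by (intro HtI simple_H borel_measurable_simple_function)

text \<open>Values are rounded towards zero, which gives |g y| <= |y| and lets second moments of Y
  control those of g(Y). Membership of g(Y) in \<open>H\<close> stays a premise: it comes later,
  from simplicity with respect to a single F_t.\<close>

lemma ex_simple_approx:
  assumes Y: "Y \<in> H" and d: "0 < d"
  shows "\<exists>g \<in> borel_measurable borel. finite (range g) \<and> (\<forall>y. \<bar>g y\<bar> \<le> \<bar>y\<bar>) \<and>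
    ((\<lambda>\<omega>. g (Y \<omega>)) \<in> H \<longrightarrow> e (\<lambda>\<omega>. \<bar>g (Y \<omega>) - Y \<omega>\<bar>) \<le> d)"
proof -
  have "\<forall>\<^sub>F n in sequentially. e (\<lambda>\<omega>. indicator {\<omega>. real n < \<bar>Y \<omega>\<bar>} \<omega> * \<bar>Y \<omega>\<bar>) < d / 2"
    using e_tail_tendsto_0[OF Y] d by (intro order_tendstoD) auto
  then obtain M :: nat where M: "e (\<lambda>\<omega>. indicator {\<omega>. real M < \<bar>Y \<omega>\<bar>} \<omega> * \<bar>Y \<omega>\<bar>) < d / 2"
    by (auto simp: eventually_sequentially)
  define r where "r = d / 2"
  have r: "0 < r" using d by (simp add: r_def)
  \<comment> \<open>Round |y| down to a multiple of the mesh r = d/2 and restore the sign; beyond M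
    the value is 0. Mesh and tail each cost at most d/2.\<close>
  define g where "g y = (if \<bar>y\<bar> \<le> real M then sgn y * (r * real_of_int \<lfloor>\<bar>y\<bar> / r\<rfloor>) else 0)" for y :: real
  have fl: "r * real_of_int \<lfloor>\<bar>y\<bar> / r\<rfloor> \<le> \<bar>y\<bar>" "\<bar>y\<bar> - r \<le> r * real_of_int \<lfloor>\<bar>y\<bar> / r\<rfloor>"
    "0 \<le> r * real_of_int \<lfloor>\<bar>y\<bar> / r\<rfloor>" for y
  proof -
    have "r * real_of_int \<lfloor>\<bar>y\<bar> / r\<rfloor> \<le> r * (\<bar>y\<bar> / r)" "r * (\<bar>y\<bar> / r - 1) \<le> r * real_of_int \<lfloor>\<bar>y\<bar> / r\<rfloor>"
      using r by (intro mult_left_mono; linarith)+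
    moreover have "r * (\<bar>y\<bar> / r) = \<bar>y\<bar>" "r * (\<bar>y\<bar> / r - 1) = \<bar>y\<bar> - r"
      using r by (simp_all add: field_simps)
    ultimately show "r * real_of_int \<lfloor>\<bar>y\<bar> / r\<rfloor> \<le> \<bar>y\<bar>" "\<bar>y\<bar> - r \<le> r * real_of_int \<lfloor>\<bar>y\<bar> / r\<rfloor>"
      by simp_all
    show "0 \<le> r * real_of_int \<lfloor>\<bar>y\<bar> / r\<rfloor>" using r by simp
  qed
  have "range g \<subseteq> (\<lambda>(s, k). s * (r * real_of_int k)) ` ({-1, 0, 1} \<times> {0..\<lfloor>real M / r\<rfloor>})" (is "_ \<subseteq> ?f ` ?S")
  proof clarify
    fix y
    show "g y \<in> ?f ` ?S"
    proof (cases "\<bar>y\<bar> \<le> real M")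
      case True
      have "\<lfloor>\<bar>y\<bar> / r\<rfloor> \<le> \<lfloor>real M / r\<rfloor>" using True r by (intro floor_mono divide_right_mono) auto
      then have "(sgn y, \<lfloor>\<bar>y\<bar> / r\<rfloor>) \<in> ?S" using r by (auto simp: sgn_if)
      then show ?thesis using True by (auto simp: g_def intro!: image_eqI[of _ _ "(sgn y, \<lfloor>\<bar>y\<bar> / r\<rfloor>)"])
    next
      case False
      have "(0, 0) \<in> ?S" using r by simp
      then show ?thesis using False by (auto simp: g_def intro!: image_eqI[of _ _ "(0, 0)"])
    qed
  qed
  then have fin: "finite (range g)" by (rule finite_subset) simp
  have gm: "g \<in> borel_measurable borel" unfolding g_def[abs_def] by measurable
  have gle: "\<bar>g y\<bar> \<le> \<bar>y\<bar>" for y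
    using fl(1,3)[of y] by (auto simp: g_def abs_mult sgn_if)
  have close: "\<bar>g y - y\<bar> \<le> r" if "\<bar>y\<bar> \<le> real M" for y
    using that fl[of y] r by (auto simp: g_def sgn_if)
  have "e (\<lambda>\<omega>. \<bar>g (Y \<omega>) - Y \<omega>\<bar>) \<le> d" if gH: "(\<lambda>\<omega>. g (Y \<omega>)) \<in> H"
  proof -
    have T: "(\<lambda>\<omega>. indicator {\<omega>. real M < \<bar>Y \<omega>\<bar>} \<omega> * \<bar>Y \<omega>\<bar>) \<in> H" (is "?T \<in> H")
      using Y by (intro H_intros tail_sets)
    have "e (\<lambda>\<omega>. \<bar>g (Y \<omega>) - Y \<omega>\<bar>) \<le> e (\<lambda>\<omega>. ?T \<omega> + r)"
    proof (intro e_mono H_intros tail_sets gH Y)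
      fix \<omega>
      show "\<bar>g (Y \<omega>) - Y \<omega>\<bar> \<le> ?T \<omega> + r"
        using close[of "Y \<omega>"] r by (cases "\<bar>Y \<omega>\<bar> \<le> real M") (auto simp: indicator_def g_def)
    qed
    also have "\<dots> = e ?T + r" using T by (rule e_add_const)
    finally show ?thesis using M by (simp add: r_def)
  qed
  then show ?thesis using fin gm gle by blast
qed

end

subsection \<open>Sums of simple functions centred under the conditional expectations\<close>

primrec stopped :: "(nat \<Rightarrow> 'a \<Rightarrow> real) \<Rightarrow> real \<Rightarrow> nat \<Rightarrow> 'a \<Rightarrow> real" where
  "stopped z c 0 = (\<lambda>\<omega>. 0)"
| "stopped z c (Suc k) = (\<lambda>\<omega>. stopped z c k \<omega> + (if \<bar>stopped z c k \<omega>\<bar> < c then z k \<omega> else 0))"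

text \<open>A path outside (-c, c) is frozen there, so ending inside means that it never
  stopped.\<close>

lemma stopped_eq_sum:
  assumes "\<bar>stopped z c n \<omega>\<bar> < c" "k \<le> n"
  shows "stopped z c k \<omega> = (\<Sum>i<k. z i \<omega>) \<and> \<bar>stopped z c k \<omega>\<bar> < c"
proof -
  have *: "\<bar>stopped z c n \<omega>\<bar> < c \<Longrightarrow> k \<le> n \<Longrightarrow> \<bar>stopped z c k \<omega>\<bar> < c" for n k
    by (induction n) (auto simp: le_Suc_eq split: if_splits)
  have "j \<le> n \<Longrightarrow> stopped z c j \<omega> = (\<Sum>i<j. z i \<omega>)" for j
  proof (induction j)
    case (Suc j)
    then have "\<bar>stopped z c j \<omega>\<bar> < c" using *[OF assms(1), of j] by simp
    then show ?case using Suc by simp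
  qed simp
  then show ?thesis using * assms by blast
qed

text \<open>\<open>Z i\<close> is the increment from time i to i + 1, hence conditioned by
  \<open>E i\<close>. Independence survives only as two conditional values, which through
  \<open>E_mult\<close> determine the conditional expectation of an F_i-simple multiple of
  \<open>Z i\<close>.\<close>

locale simple_centred_sequence = sublinear_expectation +
  fixes Z :: "nat \<Rightarrow> 'a \<Rightarrow> real"
  assumes Z_simple: "\<And>i. simple_function (Fs (Suc i)) (Z i)"
    and E_Z: "\<And>i. qs (\<lambda>\<omega>. E i (Z i) \<omega> = 0)"
    and E_neg_Z: "\<And>i. qs (\<lambda>\<omega>. E i (\<lambda>\<omega>. - Z i \<omega>) \<omega> = e (\<lambda>\<omega>. - Z i \<omega>))"
    and var_Z: "summable (\<lambda>i. e (\<lambda>\<omega>. (Z i \<omega>)\<^sup>2))"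
begin

definition s where "s i = e (\<lambda>\<omega>. (Z i \<omega>)\<^sup>2)"
text \<open>With \<open>e\<close> viewed as a supremum of means, \<open>e (Z i) = 0\<close> places
  the possible means of \<open>Z i\<close> between \<open>- m i\<close> and 0; \<open>m i\<close>
  measures the mean uncertainty.\<close>

definition m where "m i = e (\<lambda>\<omega>. - Z i \<omega>)"

lemmas sf = simple_function_add simple_function_diff simple_function_mult
  simple_function_compose1[where g = uminus] simple_function_compose1[where g = "\<lambda>x. x\<^sup>2"]
  simple_function_const

lemma Z_simple': "i < t \<Longrightarrow> simple_function (Fs t) (Z i)"
  using simple_mono[OF Z_simple, of i t] by simp

lemma Z_H: "Z i \<in> H"
  using Z_simple by (rule simple_H)

lemma stopped_simple: "simple_function (Fs (n + k)) (stopped (\<lambda>i. Z (n + i)) c k)"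
proof (induction k)
  case (Suc k)
  have "simple_function (Fs (n + Suc k)) (stopped (\<lambda>i. Z (n + i)) c k)"
    by (rule simple_mono[OF Suc]) simp
  moreover have "simple_function (Fs (n + Suc k)) (Z (n + k))" by (rule Z_simple') simp
  ultimately have "simple_function (Fs (n + Suc k))
      (\<lambda>\<omega>. (\<lambda>x y. x + (if \<bar>x\<bar> < c then y else 0)) (stopped (\<lambda>i. Z (n + i)) c k \<omega>) (Z (n + k) \<omega>))"
    by (rule simple_function_compose2)
  then show ?case by simp
qed simp

lemma s_nonneg: "0 \<le> s i"
  unfolding s_def by (intro e_nonneg simple_H[OF sf(5)[OF Z_simple]]) simp

lemma e_Z: "e (Z i) = 0"
  using e_cong_qs[OF E_H[OF Z_H] H_const E_Z] by (simp add: e_E Z_H)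

lemma m_nonneg: "0 \<le> m i"
  using e_subadd[OF Z_H H_uminus[OF Z_H], of i i] e_Z[of i] by (simp add: m_def)

text \<open>Expanding 0 <= (Z + m)^2 gives Z^2 >= 2 m (-Z) - m^2, whose right side has expectation 2
  m^2 - m^2.\<close>

lemma m_square_le: "(m i)\<^sup>2 \<le> s i"
proof -
  have Z2: "(\<lambda>\<omega>. (Z i \<omega>)\<^sup>2) \<in> H" by (intro simple_H[OF sf(5)[OF Z_simple]])
  have "e (\<lambda>\<omega>. (2 * m i) * (- Z i \<omega>) + - (m i)\<^sup>2) \<le> s i"
    unfolding s_def
  proof (intro e_mono H_intros Z_H Z2)
    fix \<omega>
    have "0 \<le> (Z i \<omega> + m i)\<^sup>2" by simp
    then show "(2 * m i) * (- Z i \<omega>) + - (m i)\<^sup>2 \<le> (Z i \<omega>)\<^sup>2"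
      by (simp add: power2_eq_square algebra_simps)
  qed
  also have "e (\<lambda>\<omega>. (2 * m i) * (- Z i \<omega>) + - (m i)\<^sup>2) = (2 * m i) * m i + - (m i)\<^sup>2"
    using m_nonneg[of i] e_scale[of "2 * m i" "\<lambda>\<omega>. - Z i \<omega>"]
    by (subst e_add_const) (auto intro!: H_scale H_uminus Z_H simp: m_def)
  finally show ?thesis by (simp add: power2_eq_square)
qed

section \<open>One-step estimates for quadratic functions of the partial sums\<close>

lemma E_simple_affine:
  assumes U: "simple_function (Fs t) U" and W: "simple_function (Fs t) W"
    and \<zeta>: "simple_function (Fs (Suc t)) \<zeta>"
  shows "(\<lambda>\<omega>. U \<omega> + W \<omega> * \<zeta> \<omega>) \<in> H"
    and "E t (\<lambda>\<omega>. U \<omega> + W \<omega> * \<zeta> \<omega>) \<omega> =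
      U \<omega> + (max (W \<omega>) 0 * E t \<zeta> \<omega> + max (- W \<omega>) 0 * E t (\<lambda>\<omega>. - \<zeta> \<omega>) \<omega>)"
proof -
  have W\<zeta>: "(\<lambda>\<omega>. W \<omega> * \<zeta> \<omega>) \<in> H"
    by (rule simple_H[of "Suc t"]) (intro sf \<zeta> simple_mono[OF W], simp)
  then show "(\<lambda>\<omega>. U \<omega> + W \<omega> * \<zeta> \<omega>) \<in> H"
    using simple_H[OF U] by (intro H_add)
  show "E t (\<lambda>\<omega>. U \<omega> + W \<omega> * \<zeta> \<omega>) \<omega> =
      U \<omega> + (max (W \<omega>) 0 * E t \<zeta> \<omega> + max (- W \<omega>) 0 * E t (\<lambda>\<omega>. - \<zeta> \<omega>) \<omega>)"
    using E_add_known[OF simple_Ht[OF U] W\<zeta>] E_mult[OF simple_Ht[OF W] simple_H[OF \<zeta>] W\<zeta>] by simp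
qed

text \<open>Given F_t, the affine expression has expectation U + W^- m quasi-surely, and W^- <=
  c.\<close>

lemma e_affine_le:
  assumes U: "simple_function (Fs t) U" and W: "simple_function (Fs t) W"
    and bound: "\<And>\<omega>. \<bar>W \<omega>\<bar> \<le> c"
  shows "e (\<lambda>\<omega>. U \<omega> + W \<omega> * Z t \<omega>) \<le> e U + c * m t"
proof -
  let ?V = "\<lambda>\<omega>. U \<omega> + W \<omega> * Z t \<omega>"
  note A = E_simple_affine[OF U W Z_simple]
  have "e (E t ?V) \<le> e (\<lambda>\<omega>. U \<omega> + c * m t)"
  proof (rule e_mono_qs[OF E_H[OF A(1)]])
    show "(\<lambda>\<omega>. U \<omega> + c * m t) \<in> H" using simple_H[OF U] by (intro H_intros)
    have "qs (\<lambda>\<omega>. E t (Z t) \<omega> = 0 \<and> E t (\<lambda>\<omega>. - Z t \<omega>) \<omega> = m t)"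
      unfolding m_def by (rule qs_conj[OF E_Z E_neg_Z])
    then show "qs (\<lambda>\<omega>. E t ?V \<omega> \<le> U \<omega> + c * m t)"
    proof (rule qs_mono)
      fix \<omega> assume *: "E t (Z t) \<omega> = 0 \<and> E t (\<lambda>\<omega>. - Z t \<omega>) \<omega> = m t"
      have "max (- W \<omega>) 0 * m t \<le> c * m t"
        using bound[of \<omega>] m_nonneg[of t] by (intro mult_right_mono) auto
      then show "E t ?V \<omega> \<le> U \<omega> + c * m t" using * A(2)[of \<omega>] by simp
    qed
  qed
  then show ?thesis using A(1) by (simp add: e_E e_add_const simple_H[OF U])
qed

text \<open>The last hypothesis says that 0 is an admissible conditional mean of \<zeta>. Then W^+
  E(\<zeta>) + W^- E(-\<zeta>) >= 0 whatever the sign and size of W, and the square splits off by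
  \<open>e_diff_ge\<close>.\<close>

lemma e_quadratic_ge:
  assumes U: "simple_function (Fs t) U" and W: "simple_function (Fs t) W"
    and \<zeta>: "simple_function (Fs (Suc t)) \<zeta>" and b: "0 \<le> b"
    and nn: "qs (\<lambda>\<omega>. 0 \<le> E t \<zeta> \<omega> \<and> 0 \<le> E t (\<lambda>\<omega>. - \<zeta> \<omega>) \<omega>)"
  shows "e U - b * e (\<lambda>\<omega>. (\<zeta> \<omega>)\<^sup>2) \<le> e (\<lambda>\<omega>. U \<omega> + W \<omega> * \<zeta> \<omega> - b * (\<zeta> \<omega>)\<^sup>2)"
proof -
  let ?V = "\<lambda>\<omega>. U \<omega> + W \<omega> * \<zeta> \<omega>"
  note A = E_simple_affine[OF U W \<zeta>]
  have \<zeta>2: "(\<lambda>\<omega>. (\<zeta> \<omega>)\<^sup>2) \<in> H" by (rule simple_H[OF sf(5)[OF \<zeta>]])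
  have "e U \<le> e (E t ?V)"
    by (rule e_mono_qs[OF simple_H[OF U] E_H[OF A(1)] qs_mono[OF nn]]) (simp add: A(2))
  then have "e U \<le> e ?V" by (simp add: e_E A(1))
  moreover have "e ?V - e (\<lambda>\<omega>. b * (\<zeta> \<omega>)\<^sup>2) \<le> e (\<lambda>\<omega>. ?V \<omega> - b * (\<zeta> \<omega>)\<^sup>2)"
    by (intro e_diff_ge A(1) H_scale \<zeta>2)
  ultimately show ?thesis using b by (simp add: e_scale \<zeta>2)
qed

text \<open>In the expanded square the cross coefficient is 2 R before stopping and 0 afterwards, so
  it is bounded by 2 c; keeping Z^2 after stopping only enlarges the bound.\<close>

lemma stopped_square_le:
  assumes c: "0 < c"
  shows "e (\<lambda>\<omega>. (stopped (\<lambda>i. Z (n + i)) c k \<omega>)\<^sup>2) \<le> (\<Sum>j<k. s (n + j) + 2 * c * m (n + j))"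
proof (induction k)
  case 0
  then show ?case by simp
next
  case (Suc k)
  let ?R = "stopped (\<lambda>i. Z (n + i)) c k"
  let ?W = "\<lambda>\<omega>. (\<lambda>x. if \<bar>x\<bar> < c then 2 * x else 0) (?R \<omega>)"
  note R = stopped_simple[of n k c]
  have R2: "simple_function (Fs (n + k)) (\<lambda>\<omega>. (?R \<omega>)\<^sup>2)" by (intro sf R)
  have W: "simple_function (Fs (n + k)) ?W" by (rule simple_function_compose1[OF R])
  have Z2: "(\<lambda>\<omega>. (Z (n + k) \<omega>)\<^sup>2) \<in> H" by (intro simple_H[OF sf(5)[OF Z_simple]])
  note V = E_simple_affine(1)[OF R2 W Z_simple]
  have "e (\<lambda>\<omega>. (stopped (\<lambda>i. Z (n + i)) c (Suc k) \<omega>)\<^sup>2)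
      \<le> e (\<lambda>\<omega>. ((?R \<omega>)\<^sup>2 + ?W \<omega> * Z (n + k) \<omega>) + (Z (n + k) \<omega>)\<^sup>2)"
  proof (intro e_mono)
    show "(\<lambda>\<omega>. (stopped (\<lambda>i. Z (n + i)) c (Suc k) \<omega>)\<^sup>2) \<in> H"
      by (rule simple_H[OF sf(5)[OF stopped_simple]])
    show "(\<lambda>\<omega>. ((?R \<omega>)\<^sup>2 + ?W \<omega> * Z (n + k) \<omega>) + (Z (n + k) \<omega>)\<^sup>2) \<in> H"
      by (intro H_add V Z2)
  qed (simp add: power2_sum)
  also have "\<dots> \<le> e (\<lambda>\<omega>. (?R \<omega>)\<^sup>2 + ?W \<omega> * Z (n + k) \<omega>) + s (n + k)"
    unfolding s_def by (rule e_subadd[OF V Z2])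
  also have "e (\<lambda>\<omega>. (?R \<omega>)\<^sup>2 + ?W \<omega> * Z (n + k) \<omega>) \<le> e (\<lambda>\<omega>. (?R \<omega>)\<^sup>2) + (2 * c) * m (n + k)"
    using c by (intro e_affine_le[OF R2 W]) auto
  finally show ?case using Suc by simp
qed

text \<open>To bound an upper expectation from below one scenario is enough, here the one of mean
  zero; hence no \<open>m\<close> appears, unlike in \<open>stopped_square_le\<close>.\<close>

lemma stopped_square_ge:
  assumes a: "0 \<le> a"
  shows "- a * (\<Sum>j<k. s j) \<le> e (\<lambda>\<omega>. - a * (stopped Z c k \<omega>)\<^sup>2)"
proof (induction k)
  case 0
  then show ?case by simp
next
  case (Suc k)
  let ?R = "stopped Z c k"
  let ?W = "\<lambda>\<omega>. (\<lambda>x. if \<bar>x\<bar> < c then - a * 2 * x else 0) (?R \<omega>)"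
  have R: "simple_function (Fs k) ?R" using stopped_simple[of 0 k c] by simp
  have U: "simple_function (Fs k) (\<lambda>\<omega>. - a * (?R \<omega>)\<^sup>2)" by (intro sf R)
  have W: "simple_function (Fs k) ?W" by (rule simple_function_compose1[OF R])
  have Z2: "(\<lambda>\<omega>. (Z k \<omega>)\<^sup>2) \<in> H" by (intro simple_H[OF sf(5)[OF Z_simple]])
  have "qs (\<lambda>\<omega>. 0 \<le> E k (Z k) \<omega> \<and> 0 \<le> E k (\<lambda>\<omega>. - Z k \<omega>) \<omega>)"
    using m_nonneg[of k] by (intro qs_mono[OF qs_conj[OF E_Z[of k] E_neg_Z[of k]]]) (simp add: m_def)
  from e_quadratic_ge[OF U W Z_simple a this]
  have "e (\<lambda>\<omega>. - a * (?R \<omega>)\<^sup>2) - a * s k \<le> e (\<lambda>\<omega>. - a * (?R \<omega>)\<^sup>2 + ?W \<omega> * Z k \<omega> - a * (Z k \<omega>)\<^sup>2)"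
    by (simp add: s_def)
  also have "\<dots> \<le> e (\<lambda>\<omega>. - a * (stopped Z c (Suc k) \<omega>)\<^sup>2)"
  proof (intro e_mono)
    show "(\<lambda>\<omega>. - a * (stopped Z c (Suc k) \<omega>)\<^sup>2) \<in> H"
      using stopped_simple[of 0 "Suc k" c] by (intro simple_H[of "Suc k"] sf) simp
    show "(\<lambda>\<omega>. - a * (?R \<omega>)\<^sup>2 + ?W \<omega> * Z k \<omega> - a * (Z k \<omega>)\<^sup>2) \<in> H"
      by (intro H_diff H_scale Z2 E_simple_affine(1)[OF U W Z_simple])
  next
    fix \<omega>
    have "0 \<le> a * (Z k \<omega>)\<^sup>2" using a by simp
    then show "- a * (?R \<omega>)\<^sup>2 + ?W \<omega> * Z k \<omega> - a * (Z k \<omega>)\<^sup>2 \<le> - a * (stopped Z c (Suc k) \<omega>)\<^sup>2"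
      by (auto simp: power2_sum algebra_simps)
  qed
  finally show ?case using Suc by (simp add: algebra_simps)
qed

text \<open>Adding m moves the admissible mean -m to 0: \<open>Z + m\<close> has conditional values
  m and 0, again nonnegative. The 4 comes from (Z + m)^2 <= 2 Z^2 + 2 m^2 and m^2 <= s. The prefix U
  is carried along so that this drift can follow a different regime before time n.\<close>

lemma shifted_sum_square_ge:
  assumes b: "0 \<le> b" and U: "simple_function (Fs n) U"
  shows "e U - b * (\<Sum>j<k. 4 * s (n + j)) \<le> e (\<lambda>\<omega>. U \<omega> - b * (\<Sum>j<k. Z (n + j) \<omega> + m (n + j))\<^sup>2)"
proof (induction k)
  case 0
  then show ?case by simp
next
  case (Suc k)
  let ?T = "\<lambda>\<omega>. \<Sum>j<k. Z (n + j) \<omega> + m (n + j)"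
  let ?\<zeta> = "\<lambda>\<omega>. Z (n + k) \<omega> + m (n + k)"
  have T: "simple_function (Fs (n + k)) ?T"
    by (intro simple_function_sum sf Z_simple') simp
  have U': "simple_function (Fs (n + k)) (\<lambda>\<omega>. U \<omega> - b * (?T \<omega>)\<^sup>2)"
    by (intro sf T simple_mono[OF U]) simp
  have W: "simple_function (Fs (n + k)) (\<lambda>\<omega>. - 2 * b * ?T \<omega>)" by (intro sf T)
  have \<zeta>: "simple_function (Fs (Suc (n + k))) ?\<zeta>" by (intro sf Z_simple)
  have E1: "E (n + k) ?\<zeta> \<omega> = m (n + k) + E (n + k) (Z (n + k)) \<omega>" for \<omega>
    using E_add_known[of "\<lambda>_. m (n + k)" "n + k" "Z (n + k)"]
    by (simp add: HtI H_const Z_H add.commute)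
  have E2: "E (n + k) (\<lambda>\<omega>. - ?\<zeta> \<omega>) \<omega> = - m (n + k) + E (n + k) (\<lambda>\<omega>. - Z (n + k) \<omega>) \<omega>" for \<omega>
    using E_add_known[of "\<lambda>_. - m (n + k)" "n + k" "\<lambda>\<omega>. - Z (n + k) \<omega>"]
    by (simp add: HtI H_const Z_H H_uminus add.commute)
  have nn: "qs (\<lambda>\<omega>. 0 \<le> E (n + k) ?\<zeta> \<omega> \<and> 0 \<le> E (n + k) (\<lambda>\<omega>. - ?\<zeta> \<omega>) \<omega>)"
    using m_nonneg[of "n + k"] unfolding E1 E2
    by (intro qs_mono[OF qs_conj[OF E_Z[of "n + k"] E_neg_Z[of "n + k"]]]) (simp add: m_def)
  have Z2: "(\<lambda>\<omega>. (Z (n + k) \<omega>)\<^sup>2) \<in> H" by (intro simple_H[OF sf(5)[OF Z_simple]])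
  have "e (\<lambda>\<omega>. (?\<zeta> \<omega>)\<^sup>2) \<le> e (\<lambda>\<omega>. 2 * (Z (n + k) \<omega>)\<^sup>2 + 2 * (m (n + k))\<^sup>2)"
  proof (intro e_mono H_intros Z2 simple_H[OF sf(5)[OF \<zeta>]])
    fix \<omega>
    have "0 \<le> (Z (n + k) \<omega> - m (n + k))\<^sup>2" by simp
    then show "(?\<zeta> \<omega>)\<^sup>2 \<le> 2 * (Z (n + k) \<omega>)\<^sup>2 + 2 * (m (n + k))\<^sup>2"
      by (simp add: power2_eq_square algebra_simps)
  qed
  also have "\<dots> = 2 * s (n + k) + 2 * (m (n + k))\<^sup>2"
    by (simp add: e_add_const e_scale H_scale Z2 s_def)
  finally have "e (\<lambda>\<omega>. (?\<zeta> \<omega>)\<^sup>2) \<le> 4 * s (n + k)" using m_square_le[of "n + k"] by simp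
  then have "b * e (\<lambda>\<omega>. (?\<zeta> \<omega>)\<^sup>2) \<le> b * (4 * s (n + k))" using b by (rule mult_left_mono)
  moreover note e_quadratic_ge[OF U' W \<zeta> b nn]
  moreover have "(\<lambda>\<omega>. U \<omega> - b * (?T \<omega>)\<^sup>2 + - 2 * b * ?T \<omega> * ?\<zeta> \<omega> - b * (?\<zeta> \<omega>)\<^sup>2)
      = (\<lambda>\<omega>. U \<omega> - b * (\<Sum>j<Suc k. Z (n + j) \<omega> + m (n + j))\<^sup>2)"
    by (simp add: fun_eq_iff power2_eq_square algebra_simps)
  ultimately show ?case using Suc by (simp add: distrib_left)
qed

lemma partial_sums_measurable [measurable]: "(\<lambda>\<omega>. \<Sum>i<k. Z (n + i) \<omega>) \<in> borel_measurable (Finf Fs)"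
  using H_measurable[OF Z_H] by measurable

lemma exceed_sets: "{\<omega>. c \<le> \<bar>\<Sum>i<k. Z (n + i) \<omega>\<bar>} \<in> sets (Finf Fs)"
  using measurable_sets[OF borel_measurable_abs[OF partial_sums_measurable], of "{c..}"]
  by (simp add: vimage_def)

text \<open>
  If \<open>\<Sum> m i\<close> diverged, the increments could be driven with mean zero up to time \<open>n\<close> and with
  mean \<open>- m i\<close> afterwards; so \<open>D n\<close> below would have capacity at least \<open>1/2\<close> for every \<open>n\<close>,
  although these events decrease to the empty set.
\<close>
lemma summable_m: "summable m"
proof (rule ccontr)
  assume div: "\<not> summable m"
  define S where "S = suminf s"
  have summ: "summable s" using var_Z by (simp add: s_def[abs_def])
  have S: "(\<Sum>j\<in>J. s j) \<le> S" if "finite J" for J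
    unfolding S_def using summ s_nonneg that by (intro sum_le_suminf) auto
  have S0: "0 \<le> S" using S[of "{}"] by simp
  \<comment> \<open>K^2 >= 4 S, so penalising exits from (-K, K) with weight 1/K^2 costs at most
    1/4.\<close>
  define K where "K = 2 * sqrt S + 1"
  have K: "0 < K" "4 * S \<le> K\<^sup>2"
    using S0 by (auto simp: K_def power2_sum power_mult_distrib intro: add_nonneg_pos)
  define P where "P k \<omega> = (\<Sum>i<k. Z i \<omega>)" for k \<omega>
  have P[measurable]: "P k \<in> borel_measurable (Finf Fs)" for k
    using partial_sums_measurable[of 0 k] by (simp add: P_def[abs_def])
  \<comment> \<open>A path in every \<open>D n\<close> would have to be both below -2K and within K
    at the index k of its low partial sum.\<close>
  define D where "D n = {\<omega>. (\<forall>k\<in>{..n}. \<bar>P k \<omega>\<bar> < K) \<and> (\<exists>k. P k \<omega> < - 2 * K)}" for n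
  have D: "D n \<in> sets (Finf Fs)" for n
  proof -
    have "{\<omega> \<in> space (Finf Fs). (\<forall>k\<in>{..n}. \<bar>P k \<omega>\<bar> < K) \<and> (\<exists>k. P k \<omega> < - 2 * K)} \<in> sets (Finf Fs)"
      by measurable
    then show ?thesis by (simp add: D_def)
  qed
  have "(\<lambda>n. e (indicator (D n))) \<longlonglongrightarrow> 0"
  proof (rule V_continuous[OF D])
    show "D (Suc n) \<subseteq> D n" for n by (auto simp: D_def)
    show "(\<Inter>n. D n) = {}"
    proof (safe, simp)
      fix \<omega> assume *: "\<forall>n. \<omega> \<in> D n"
      then obtain k where "P k \<omega> < - 2 * K" by (auto simp: D_def)
      moreover have "\<bar>P k \<omega>\<bar> < K" using *[rule_format, of k] by (auto simp: D_def)
      ultimately show False using K by linarith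
    qed
  qed
  then have "\<forall>\<^sub>F n in sequentially. e (indicator (D n)) < 1/2" by (rule order_tendstoD) simp
  then obtain n where n: "e (indicator (D n)) < 1/2" by (auto simp: eventually_sequentially)
  have "\<not> summable (\<lambda>j. m (j + n))" using div by simp
  then have "\<not> (\<forall>j. (\<Sum>i<j. m (i + n)) \<le> 7 * K)"
    using summableI_nonneg_bounded[of "\<lambda>j. m (j + n)" "7 * K"] m_nonneg by blast
  then obtain j where j: "7 * K < (\<Sum>i<j. m (n + i))" by (auto simp: not_le add.commute)
  define L where "L = (\<Sum>i<j. m (n + i))"
  \<comment> \<open>If |P n| < K and T < c, then P (n + j) < K + c - L = -2K, which dictates c. The
    threshold 7K yields c > 4K, so the penalty on T costs at most 1/16.\<close>
  define c where "c = L - 3 * K"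
  have c: "4 * K < c" "0 < c" using j K by (auto simp: c_def L_def)
  define a where "a = 1 / K\<^sup>2"
  define b where "b = 1 / c\<^sup>2"
  have ab: "0 \<le> a" "0 \<le> b" by (auto simp: a_def b_def)
  let ?R = "stopped Z K n"
  let ?T = "\<lambda>\<omega>. \<Sum>i<j. Z (n + i) \<omega> + m (n + i)"
  let ?U = "\<lambda>\<omega>. - a * (?R \<omega>)\<^sup>2"
  have U: "simple_function (Fs n) ?U" using stopped_simple[of 0 n K] by (intro sf) simp
  have T: "simple_function (Fs (n + j)) ?T" by (intro simple_function_sum sf Z_simple') simp
  have F: "simple_function (Fs (n + j)) (\<lambda>\<omega>. ?U \<omega> - b * (?T \<omega>)\<^sup>2)"
    by (intro sf simple_mono[OF U] T) simp
  \<comment> \<open>A quadratic minorant of the indicator: off \<open>D n\<close> either the stopped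
    path has left (-K, K) or T >= c, and that penalty is at least 1. The expectation of the minorant
    is at least 1 - 1/4 - 1/16, above 1/2.\<close>
  have "e (\<lambda>\<omega>. (?U \<omega> - b * (?T \<omega>)\<^sup>2) + 1) \<le> e (indicator (D n))"
  proof (intro e_mono H_add H_const simple_H[OF F] H_indicator D)
    fix \<omega>
    show "(?U \<omega> - b * (?T \<omega>)\<^sup>2) + 1 \<le> indicator (D n) \<omega>"
    proof (cases "\<bar>?R \<omega>\<bar> < K")
      case False
      then have "K\<^sup>2 \<le> (?R \<omega>)\<^sup>2" using K by (simp add: abs_le_square_iff[symmetric])
      then have "1 \<le> a * (?R \<omega>)\<^sup>2" using K by (simp add: a_def)
      moreover have "0 \<le> b * (?T \<omega>)\<^sup>2" using ab by simp
      ultimately show ?thesis by (simp add: indicator_def)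
    next
      case True
      then have small: "\<bar>P k \<omega>\<bar> < K" if "k \<le> n" for k
        using stopped_eq_sum[of Z K n \<omega> k, OF _ that] True by (auto simp: P_def)
      have U0: "?U \<omega> \<le> 0" using ab by (simp add: mult_nonneg_nonneg)
      have PnT: "P (n + j) \<omega> = P n \<omega> + (?T \<omega> - L)"
      proof -
        have "P (n + j) \<omega> = P n \<omega> + (\<Sum>i<j. Z (n + i) \<omega>)" unfolding P_def
          by (induction j) auto
        then show ?thesis by (simp add: L_def sum.distrib)
      qed
      show ?thesis
      proof (cases "?T \<omega> < c")
        case True
        then have "P (n + j) \<omega> < - 2 * K" using small[of n] PnT by (simp add: c_def)
        then have "\<omega> \<in> D n" using small by (auto simp: D_def)
        moreover have "0 \<le> b * (?T \<omega>)\<^sup>2" using ab by simp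
        ultimately show ?thesis using U0 by simp
      next
        case False
        then have "c\<^sup>2 \<le> (?T \<omega>)\<^sup>2" using c by (intro power_mono) auto
        then have "1 \<le> b * (?T \<omega>)\<^sup>2" using c by (simp add: b_def)
        then show ?thesis using U0 by (simp add: indicator_def)
      qed
    qed
  qed
  moreover have "e (\<lambda>\<omega>. (?U \<omega> - b * (?T \<omega>)\<^sup>2) + 1) = e (\<lambda>\<omega>. ?U \<omega> - b * (?T \<omega>)\<^sup>2) + 1"
    by (rule e_add_const[OF simple_H[OF F]])
  moreover have "e ?U - b * (\<Sum>i<j. 4 * s (n + i)) \<le> e (\<lambda>\<omega>. ?U \<omega> - b * (?T \<omega>)\<^sup>2)"
    by (rule shifted_sum_square_ge[OF ab(2) U])
  moreover have "- a * (\<Sum>i<n. s i) \<le> e ?U" by (rule stopped_square_ge[OF ab(1)])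
  moreover have "a * (\<Sum>i<n. s i) \<le> 1/4"
  proof -
    have "a * (\<Sum>i<n. s i) \<le> a * (K\<^sup>2 / 4)" using S[of "{..<n}"] K ab by (intro mult_left_mono) auto
    then show ?thesis using K by (simp add: a_def)
  qed
  moreover have "b * (\<Sum>i<j. 4 * s (n + i)) \<le> 1/16"
  proof -
    have "(\<Sum>i<j. s (n + i)) = (\<Sum>i\<in>(+) n ` {..<j}. s i)" by (simp add: sum.reindex)
    then have "(\<Sum>i<j. s (n + i)) \<le> S" using S[of "(+) n ` {..<j}"] by simp
    then have "(\<Sum>i<j. 4 * s (n + i)) \<le> K\<^sup>2" using K by (simp add: sum_distrib_left[symmetric])
    also have "\<dots> \<le> c\<^sup>2 / 16"
      using power_mono[of "4 * K" c 2] c K by (simp add: power_mult_distrib)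
    finally have "b * (\<Sum>i<j. 4 * s (n + i)) \<le> b * (c\<^sup>2 / 16)" using ab by (intro mult_left_mono)
    then show ?thesis using c by (simp add: b_def)
  qed
  ultimately show False using n by linarith
qed

text \<open>If a partial sum before N reaches level c, the stopped sum ends outside (-c, c). Markov
  for its square bounds the finite unions uniformly in N.\<close>

lemma maximal_inequality:
  assumes c: "0 < c"
  shows "e (indicator (\<Union>k. {\<omega>. c \<le> \<bar>\<Sum>i<k. Z (n + i) \<omega>\<bar>})) \<le> (\<Sum>j. s (j + n) + 2 * c * m (j + n)) / c\<^sup>2"
    (is "e (indicator (\<Union>k. ?B k)) \<le> ?q / c\<^sup>2")
proof (rule V_UN_le)
  show B: "?B k \<in> sets (Finf Fs)" for k
    by (rule exceed_sets)
  fix N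
  let ?R = "stopped (\<lambda>i. Z (n + i)) c N"
  have R2: "(\<lambda>\<omega>. (?R \<omega>)\<^sup>2) \<in> H" by (rule simple_H[OF sf(5)[OF stopped_simple]])
  have "e (indicator (\<Union>k<N. ?B k)) \<le> e (\<lambda>\<omega>. (?R \<omega>)\<^sup>2) / c\<^sup>2"
  proof (rule markov[OF R2])
    show "(\<Union>k<N. ?B k) \<in> sets (Finf Fs)" using B by auto
    show "c\<^sup>2 \<le> (?R \<omega>)\<^sup>2" if hit: "\<omega> \<in> (\<Union>k<N. ?B k)" for \<omega>
    proof -
      obtain k where k: "k < N" "c \<le> \<bar>\<Sum>i<k. Z (n + i) \<omega>\<bar>"
        using hit by auto
      have "\<not> \<bar>?R \<omega>\<bar> < c"
        using stopped_eq_sum[of "\<lambda>i. Z (n + i)" c N \<omega> k] k by auto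
      then show ?thesis using c by (simp add: abs_le_square_iff[symmetric])
    qed
  qed (use c in auto)
  also have "\<dots> \<le> (\<Sum>j<N. s (n + j) + 2 * c * m (n + j)) / c\<^sup>2"
    by (intro divide_right_mono stopped_square_le c) simp
  also have "(\<Sum>j<N. s (n + j) + 2 * c * m (n + j)) \<le> ?q"
  proof -
    have "summable s" using var_Z by (simp add: s_def[abs_def])
    then have "summable (\<lambda>j. s (j + n) + 2 * c * m (j + n))"
      using summable_m by (intro summable_add summable_mult) simp_all
    then show ?thesis using sum_le_suminf[of "\<lambda>j. s (j + n) + 2 * c * m (j + n)" "{..<N}"] c s_nonneg m_nonneg
      by (simp add: add.commute)
  qed
  finally show "e (indicator (\<Union>k<N. ?B k)) \<le> ?q / c\<^sup>2"
    by (simp add: divide_right_mono)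
qed

text \<open>The exceptional event lies in the exceedance event of every single n, whose bound is a
  tail of a convergent series divided by the fixed c^2.\<close>

lemma qs_cauchy:
  assumes c: "0 < c"
  shows "qs (\<lambda>\<omega>. \<exists>n. \<forall>k. \<bar>\<Sum>i<k. Z (n + i) \<omega>\<bar> < c)"
proof -
  let ?B = "\<lambda>n. \<Union>k. {\<omega>. c \<le> \<bar>\<Sum>i<k. Z (n + i) \<omega>\<bar>}"
  have B: "?B n \<in> sets (Finf Fs)" for n
    using exceed_sets by auto
  then have I: "(\<Inter>n. ?B n) \<in> sets (Finf Fs)" by auto
  have "e (indicator (\<Inter>n. ?B n)) \<le> 0"
  proof (rule field_le_epsilon)
    fix r :: real assume r: "0 < r"
    have "summable s" using var_Z by (simp add: s_def[abs_def])
    then have "summable (\<lambda>j. s j + 2 * c * m j)"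
      using summable_m by (intro summable_add summable_mult) simp_all
    then obtain n where n: "norm (\<Sum>j. s (j + n) + 2 * c * m (j + n)) < r * c\<^sup>2"
      using suminf_exist_split[of "r * c\<^sup>2" "\<lambda>j. s j + 2 * c * m j"] r c by auto
    have "e (indicator (\<Inter>n. ?B n)) \<le> e (indicator (?B n))"
      using I B by (intro V_mono) auto
    also have "\<dots> \<le> (\<Sum>j. s (j + n) + 2 * c * m (j + n)) / c\<^sup>2" by (rule maximal_inequality[OF c])
    also have "\<dots> \<le> r" using n c by (simp add: divide_le_eq)
    finally show "e (indicator (\<Inter>n. ?B n)) \<le> 0 + r" by simp
  qed
  then have "e (indicator (\<Inter>n. ?B n)) = 0" using V_nonneg[OF I] by linarith
  then show ?thesis using I unfolding quasi_surely_def
    by (intro bexI[of _ "\<Inter>n. ?B n"]) (auto simp: not_le)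
qed

theorem qs_summable: "qs (\<lambda>\<omega>. summable (\<lambda>i. Z i \<omega>))"
proof -
  have "qs (\<lambda>\<omega>. \<forall>l. \<exists>n. \<forall>k. \<bar>\<Sum>i<k. Z (n + i) \<omega>\<bar> < inverse (real (Suc l)))"
    by (intro qs_all_nat qs_cauchy) simp
  then show ?thesis
  proof (rule qs_mono)
    fix \<omega> assume *: "\<forall>l. \<exists>n. \<forall>k. \<bar>\<Sum>i<k. Z (n + i) \<omega>\<bar> < inverse (real (Suc l))"
    show "summable (\<lambda>i. Z i \<omega>)"
      unfolding summable_Cauchy
    proof (intro allI impI)
      fix r :: real assume "0 < r"
      \<comment> \<open>A block starting at a >= n is the difference of two blocks starting at n,
        hence r / 2 for each.\<close>
      then obtain l where l: "inverse (real (Suc l)) < r / 2" using reals_Archimedean[of "r / 2"] by auto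
      obtain n where n: "\<And>k. \<bar>\<Sum>i<k. Z (n + i) \<omega>\<bar> < inverse (real (Suc l))" using * by blast
      have n': "\<bar>\<Sum>i\<in>{n..<p}. Z i \<omega>\<bar> < r / 2" if "n \<le> p" for p
      proof -
        have "(\<Sum>i\<in>{n..<p}. Z i \<omega>) = (\<Sum>i<p - n. Z (n + i) \<omega>)"
          using sum.shift_bounds_nat_ivl[of "\<lambda>i. Z i \<omega>" 0 n "p - n"] that
          by (simp add: atLeast0LessThan add.commute)
        then show ?thesis using n[of "p - n"] l by linarith
      qed
      have "norm (\<Sum>i\<in>{a..<p}. Z i \<omega>) < r" if a: "n \<le> a" for a p
      proof (cases "a \<le> p")
        case True
        have "(\<Sum>i\<in>{n..<p}. Z i \<omega>) = (\<Sum>i\<in>{n..<a}. Z i \<omega>) + (\<Sum>i\<in>{a..<p}. Z i \<omega>)"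
          using a True by (simp add: sum.atLeastLessThan_concat)
        then show ?thesis using n'[OF a] n'[of p] a True unfolding real_norm_def by linarith
      next
        case False
        then show ?thesis using \<open>0 < r\<close> by simp
      qed
      then show "\<exists>N. \<forall>m\<ge>N. \<forall>p. norm (\<Sum>i\<in>{m..<p}. Z i \<omega>) < r" by blast
    qed
  qed
qed

end

section \<open>Passage from simple increments to the given ones\<close>

theorem theorem4p2:
  fixes Fs :: "nat \<Rightarrow> 'a measure"
    and H :: "('a \<Rightarrow> real) set"
    and E :: "nat \<Rightarrow> ('a \<Rightarrow> real) \<Rightarrow> ('a \<Rightarrow> real)"
    and X :: "nat \<Rightarrow> 'a \<Rightarrow> real"
  assumes filt: "std_filtration Fs"
    and HH: "admissible_space Fs H"
    and SL: "SL_expectation Fs H E"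
    and XH: "\<And>i. i \<ge> 1 \<Longrightarrow> X i \<in> Ht Fs H i"
    and Xindep: "\<And>i. i \<ge> 1 \<Longrightarrow> indep_of_filt Fs H E (X i) (i - 1)"
    and Xreg: "\<And>i. i \<ge> 1 \<Longrightarrow> (\<exists>c. \<forall>\<omega>. c \<le> X i \<omega>) \<or> L1b E (X i)"
    and sqH: "\<And>i. i \<ge> 1 \<Longrightarrow> (\<lambda>\<omega>. (X i \<omega> - expc E (X i))\<^sup>2) \<in> H"
    and var: "summable (\<lambda>i. expc E (\<lambda>\<omega>. (X (Suc i) \<omega> - expc E (X (Suc i)))\<^sup>2))"
  shows "quasi_surely Fs E (\<lambda>\<omega>. summable (\<lambda>i. X (Suc i) \<omega> - expc E (X (Suc i))))"
proof -
  interpret sublinear_expectation Fs H E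
    using filt HH SL by unfold_locales
  define Y where "Y i \<omega> = X (Suc i) \<omega> - e (X (Suc i))" for i \<omega>
  have X: "X (Suc i) \<in> H" "X (Suc i) \<in> borel_measurable (Fs (Suc i))" for i
    using XH[of "Suc i"] by (auto simp: Ht_def)
  have Y: "Y i \<in> H" "Y i \<in> borel_measurable (Fs (Suc i))" for i
    using X[of i] by (auto simp: Y_def[abs_def] intro!: H_intros)
  have eY: "e (Y i) = 0" for i
    using e_add_const[OF X(1), of i "- e (X (Suc i))"] by (simp add: Y_def[abs_def])
  have Y2: "(\<lambda>\<omega>. (Y i \<omega>)\<^sup>2) \<in> H" for i using sqH[of "Suc i"] by (simp add: Y_def)
  \<comment> \<open>With error (1/4)^i, Markov at level (1/2)^i leaves capacity (1/2)^i, so levels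
    and capacities are both summable.\<close>
  have "\<forall>i. \<exists>g. g \<in> borel_measurable borel \<and> finite (range g) \<and> (\<forall>y. \<bar>g y\<bar> \<le> \<bar>y\<bar>) \<and>
      ((\<lambda>\<omega>. g (Y i \<omega>)) \<in> H \<longrightarrow> e (\<lambda>\<omega>. \<bar>g (Y i \<omega>) - Y i \<omega>\<bar>) \<le> (1/4) ^ i)"
    using ex_simple_approx[OF Y(1)] by (meson zero_less_power zero_less_divide_1_iff zero_less_numeral)
  then obtain g where g: "\<And>i. g i \<in> borel_measurable borel" "\<And>i. finite (range (g i))"
    "\<And>i y. \<bar>g i y\<bar> \<le> \<bar>y\<bar>"
    "\<And>i. (\<lambda>\<omega>. g i (Y i \<omega>)) \<in> H \<Longrightarrow> e (\<lambda>\<omega>. \<bar>g i (Y i \<omega>) - Y i \<omega>\<bar>) \<le> (1/4) ^ i"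
    by metis
  define G where "G i \<omega> = g i (Y i \<omega>)" for i \<omega>
  define d where "d i = e (G i)" for i
  \<comment> \<open>Rounding shifts the expectation by \<open>d i\<close>; recentring restores mean
    zero, and the shifts are summable.\<close>
  define Z where "Z i \<omega> = G i \<omega> - d i" for i \<omega>
  have G_simple: "simple_function (Fs (Suc i)) (G i)" for i
  proof (rule simple_function_borel_measurable)
    show "G i \<in> borel_measurable (Fs (Suc i))"
      unfolding G_def by (rule measurable_compose[OF Y(2) g(1)])
    show "finite (G i ` space (Fs (Suc i)))"
      by (rule finite_subset[OF _ g(2)[of i]]) (auto simp: G_def)
  qed
  note G = simple_H[OF G_simple]
  have err: "e (\<lambda>\<omega>. \<bar>G i \<omega> - Y i \<omega>\<bar>) \<le> (1/4) ^ i" for i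
    using g(4)[of i] G[of i] by (simp add: G_def[abs_def])
  have d: "\<bar>d i\<bar> \<le> (1/4) ^ i" for i
    using e_diff_abs_le[OF G Y(1), of i i] err[of i] eY[of i] by (simp add: d_def)
  have Z_simple: "simple_function (Fs (Suc i)) (Z i)" for i
    using G_simple[of i] by (simp add: Z_def[abs_def])
  note Z = simple_H[OF Z_simple]
  have eZ: "e (Z i) = 0" for i
    using e_add_const[OF G, of i "- d i"] by (simp add: Z_def[abs_def] d_def)
  \<comment> \<open>Independence is assumed of X, so Z is exhibited as a Borel function of
    X.\<close>
  have Z_X: "Z i = (\<lambda>\<omega>. (\<lambda>x. g i (x - e (X (Suc i))) - d i) (X (Suc i) \<omega>))" for i
    by (simp add: Z_def G_def Y_def fun_eq_iff)
  have h: "(\<lambda>x. g i (x - e (X (Suc i))) - d i) \<in> borel_measurable borel"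
    "(\<lambda>x. - (g i (x - e (X (Suc i))) - d i)) \<in> borel_measurable borel" for i
    using g(1)[of i] by measurable
  have ind: "indep_of_filt Fs H E (X (Suc i)) i" for i using Xindep[of "Suc i"] by simp
  interpret Z: simple_centred_sequence Fs H E Z
  proof
    show "simple_function (Fs (Suc i)) (Z i)" for i by (rule Z_simple)
    show "qs (\<lambda>\<omega>. E i (Z i) \<omega> = 0)" for i
      using E_indep[OF X(1)[of i] _ h(1)[of i] ind] Z[of i] eZ[of i] by (simp add: Z_X)
    show "qs (\<lambda>\<omega>. E i (\<lambda>\<omega>. - Z i \<omega>) \<omega> = e (\<lambda>\<omega>. - Z i \<omega>))" for i
      using E_indep[OF X(1)[of i] _ h(2)[of i] ind] H_uminus[OF Z[of i]] by (simp add: Z_X)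
    show "summable (\<lambda>i. e (\<lambda>\<omega>. (Z i \<omega>)\<^sup>2))"
    proof (rule summable_comparison_test')
      have "summable (\<lambda>i. e (\<lambda>\<omega>. (Y i \<omega>)\<^sup>2))" using var by (simp add: Y_def)
      then show "summable (\<lambda>i. 2 * e (\<lambda>\<omega>. (Y i \<omega>)\<^sup>2) + 2 * (1/4) ^ i)"
        by (intro summable_add summable_mult summable_geometric) auto
      fix i
      have Z2: "(\<lambda>\<omega>. (Z i \<omega>)\<^sup>2) \<in> H"
        by (rule simple_H[OF simple_function_compose1[OF Z_simple]])
      \<comment> \<open>Rounding towards zero pays off here: Z^2 <= 2 G^2 + 2 d^2 with G^2 <=
        Y^2.\<close>
      have "e (\<lambda>\<omega>. (Z i \<omega>)\<^sup>2) \<le> e (\<lambda>\<omega>. 2 * (Y i \<omega>)\<^sup>2 + 2 * (1/4) ^ i)"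
      proof (intro e_mono H_intros Y2 Z2)
        fix \<omega>
        have "0 \<le> (G i \<omega> + d i)\<^sup>2" by simp
        then have "(Z i \<omega>)\<^sup>2 \<le> 2 * (G i \<omega>)\<^sup>2 + 2 * (d i)\<^sup>2"
          by (simp add: Z_def power2_eq_square algebra_simps)
        also have "(G i \<omega>)\<^sup>2 \<le> (Y i \<omega>)\<^sup>2"
          using g(3)[of i "Y i \<omega>"] by (simp add: G_def abs_le_square_iff)
        also have "(d i)\<^sup>2 \<le> (1/4) ^ i"
        proof -
          have "(d i)\<^sup>2 \<le> ((1/4) ^ i)\<^sup>2" using d[of i] by (simp add: abs_le_square_iff[symmetric])
          also have "\<dots> \<le> (1/4) ^ i"
            by (simp add: power2_eq_square mult_left_le_one_le power_le_one)
          finally show ?thesis .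
        qed
        finally show "(Z i \<omega>)\<^sup>2 \<le> 2 * (Y i \<omega>)\<^sup>2 + 2 * (1/4) ^ i" by simp
      qed
      also have "\<dots> = 2 * e (\<lambda>\<omega>. (Y i \<omega>)\<^sup>2) + 2 * (1/4) ^ i"
        by (simp add: e_add_const e_scale H_scale Y2)
      finally show "norm (e (\<lambda>\<omega>. (Z i \<omega>)\<^sup>2)) \<le> 2 * e (\<lambda>\<omega>. (Y i \<omega>)\<^sup>2) + 2 * (1/4) ^ i"
        using e_nonneg[OF Z2] by simp
    qed
  qed
  \<comment> \<open>The doubled absolute value is the form in which \<open>tail_sets\<close> applies
    to |G - Y|.\<close>
  define A where "A i = {\<omega>. (1/2) ^ i < \<bar>\<bar>G i \<omega> - Y i \<omega>\<bar>\<bar>}" for i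
  have D: "(\<lambda>\<omega>. \<bar>G i \<omega> - Y i \<omega>\<bar>) \<in> H" for i using G Y by (intro H_intros)
  have A: "A i \<in> sets (Finf Fs)" for i
    unfolding A_def by (rule tail_sets[OF D])
  have "e (indicator (A i)) \<le> (1/2) ^ i" for i
  proof -
    have "e (indicator (A i)) \<le> e (\<lambda>\<omega>. \<bar>G i \<omega> - Y i \<omega>\<bar>) / (1/2) ^ i"
      by (rule markov[OF D A]) (auto simp: A_def)
    also have "\<dots> \<le> (1/4) ^ i / (1/2) ^ i" by (rule divide_right_mono[OF err]) simp
    also have "\<dots> = (1/2) ^ i" by (simp add: power_divide[symmetric])
    finally show ?thesis .
  qed
  then have "summable (\<lambda>i. e (indicator (A i)))"
    using V_nonneg[OF A] by (intro summable_comparison_test'[OF summable_geometric[of "1/2"]]) auto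
  from qs_conj[OF Z.qs_summable borel_cantelli[OF A this]]
  have "qs (\<lambda>\<omega>. summable (\<lambda>i. Y i \<omega>))"
  proof (rule qs_mono, elim conjE exE)
    fix \<omega> n assume Zs: "summable (\<lambda>i. Z i \<omega>)" and n: "\<forall>i\<ge>n. \<omega> \<notin> A i"
    have "summable (\<lambda>i. G i \<omega> - Y i \<omega>)"
      using n by (intro summable_comparison_test'[OF summable_geometric[of "1/2"], of n]) (auto simp: A_def not_less)
    moreover have "summable d"
      using d by (intro summable_comparison_test'[OF summable_geometric[of "1/4"], of 0]) auto
    ultimately have "summable (\<lambda>i. (Z i \<omega> + d i) - (G i \<omega> - Y i \<omega>))"
      by (intro summable_diff[OF summable_add[OF Zs]])
    then show "summable (\<lambda>i. Y i \<omega>)" by (simp add: Z_def)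
  qed
  then show ?thesis by (simp add: Y_def)
qed

end
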